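(* Let $E\subset L_1(0,1)$ be a fully symmetric Banach space on the interval $(0,1)$. For every given $0\le x\in E$, there exists a singular fully symmetric linear functional $\varphi_{sing}$ on $E$ such that $$\varphi_{sing}(x)=\lim_{m\to\infty}\frac1m\|\sigma_m(\mu(x))\|_E.$$
   Context: For a measurable function $x$ on $(0,1)$, $\mu(t,x)=\inf\{s\ge0:\ |\{|x|>s\}|\le t\}$ (Lebesgue measure) is its decreasing rearrangement; $y\prec\prec x$ means $\int_0^t\mu(s,y)ds\le\int_0^t\mu(s,x)ds$ for all $t\ge0$. A fully symmetric Banach space $E$ on $(0,1)$ is a Banach space of (real-valued) functions $E\subset L_1(0,1)$ such that $x\in E$, $y\in L_1(0,1)$ and $y\prec\prec x$ imply $y\in E$ and $\|y\|_E\le\|x\|_E$. For $m\in\mathbb{N}$ the dilation operator on functions on $(0,1)$ is $(\sigma_mx)(t)=x(t/m)$, $0<t\le1$. A linear functional $\varphi$ on $E$ is fully symmetric if $\varphi(y)\le\varphi(x)$ for all $0\le x,y\in E$ with $y\prec\prec x$, and singular if $\varphi=0$ on $(L_1\cap L_\infty)(0,1)=L_\infty(0,1)$. *)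

theory Defs
  imports "HOL-Analysis.Analysis"
begin

text \<open>
  Functions on \<open>(0,1)\<close> are represented by \<^typ>\<open>real \<Rightarrow> real\<close>, their values outside the interval being
  irrelevant. Almost everywhere equal functions are not identified syntactically; instead all
  notions below are invariant under almost everywhere equality.
\<close>

abbreviation unit_interval_measure :: "real measure" where
  "unit_interval_measure \<equiv> lebesgue_on {0<..<1}"

definition L1 :: "(real \<Rightarrow> real) set" where
  "L1 = {f. integrable unit_interval_measure f}"

definition Linf :: "(real \<Rightarrow> real) set" where
  "Linf = {f \<in> borel_measurable unit_interval_measure.
             \<exists>C. AE t in unit_interval_measure. \<bar>f t\<bar> \<le> C}"

text \<open>
  For \<open>t > 0\<close> and measurable \<open>x\<close> the set below is nonempty, so the infimum is genuine. For \<open>t = 0\<close>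
  and essentially unbounded \<open>x\<close> the usual value is \<open>\<infinity>\<close>, whereas here it is the unspecified real
  \<^term>\<open>Inf {} :: real\<close>; this value has no influence on anything that follows, since it concerns a
  single point that is negligible for integrals and lies outside \<open>(0,1)\<close>.
\<close>
definition rearrangement :: "(real \<Rightarrow> real) \<Rightarrow> real \<Rightarrow> real" where
  "rearrangement x t =
     Inf {s. 0 \<le> s \<and> measure unit_interval_measure {u \<in> {0<..<1}. \<bar>x u\<bar> > s} \<le> t}"

definition submajorized :: "(real \<Rightarrow> real) \<Rightarrow> (real \<Rightarrow> real) \<Rightarrow> bool"  (infix "\<prec>\<prec>" 50) where
  "y \<prec>\<prec> x \<longleftrightarrow>
     (\<forall>t\<ge>0. (\<integral>\<^sup>+s\<in>{0..t}. ennreal (rearrangement y s) \<partial>lborel)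
             \<le> (\<integral>\<^sup>+s\<in>{0..t}. ennreal (rearrangement x s) \<partial>lborel))"

definition dilation :: "nat \<Rightarrow> (real \<Rightarrow> real) \<Rightarrow> real \<Rightarrow> real" where
  "dilation m x = (\<lambda>t. x (t / real m))"

definition banach_function_space :: "(real \<Rightarrow> real) set \<Rightarrow> ((real \<Rightarrow> real) \<Rightarrow> real) \<Rightarrow> bool" where
  "banach_function_space E N \<longleftrightarrow>
     (\<lambda>t. 0) \<in> E \<and>
     (\<forall>f\<in>E. \<forall>g\<in>E. (\<lambda>t. f t + g t) \<in> E) \<and>
     (\<forall>c. \<forall>f\<in>E. (\<lambda>t. c * f t) \<in> E) \<and>
     (\<forall>f\<in>E. 0 \<le> N f) \<and>
     (\<forall>f\<in>E. N f = 0 \<longleftrightarrow> (AE t in unit_interval_measure. f t = 0)) \<and>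
     (\<forall>c. \<forall>f\<in>E. N (\<lambda>t. c * f t) = \<bar>c\<bar> * N f) \<and>
     (\<forall>f\<in>E. \<forall>g\<in>E. N (\<lambda>t. f t + g t) \<le> N f + N g) \<and>
     (\<forall>X. (\<forall>n::nat. X n \<in> E) \<and>
          (\<forall>e>0. \<exists>M. \<forall>m\<ge>M. \<forall>n\<ge>M. N (\<lambda>t. X m t - X n t) < e) \<longrightarrow>
          (\<exists>f\<in>E. (\<lambda>n. N (\<lambda>t. X n t - f t)) \<longlonglongrightarrow> 0))"

text \<open>
  The last condition entails that \<open>E\<close> is closed under almost everywhere equality of measurable
  functions and that \<open>N\<close> depends only on the almost everywhere class.
\<close>
definition fully_symmetric_banach_space ::
    "(real \<Rightarrow> real) set \<Rightarrow> ((real \<Rightarrow> real) \<Rightarrow> real) \<Rightarrow> bool" where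
  "fully_symmetric_banach_space E N \<longleftrightarrow>
     banach_function_space E N \<and> E \<subseteq> L1 \<and>
     (\<forall>x\<in>E. \<forall>y\<in>L1. y \<prec>\<prec> x \<longrightarrow> y \<in> E \<and> N y \<le> N x)"

text \<open>The first clause says that the functional is well defined on almost everywhere classes.\<close>
definition linear_functional_on ::
    "(real \<Rightarrow> real) set \<Rightarrow> ((real \<Rightarrow> real) \<Rightarrow> real) \<Rightarrow> bool" where
  "linear_functional_on E \<phi> \<longleftrightarrow>
     (\<forall>f\<in>E. \<forall>g\<in>E. (AE t in unit_interval_measure. f t = g t) \<longrightarrow> \<phi> f = \<phi> g) \<and>
     (\<forall>f\<in>E. \<forall>g\<in>E. \<phi> (\<lambda>t. f t + g t) = \<phi> f + \<phi> g) \<and>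
     (\<forall>c. \<forall>f\<in>E. \<phi> (\<lambda>t. c * f t) = c * \<phi> f)"

definition fully_symmetric_functional ::
    "(real \<Rightarrow> real) set \<Rightarrow> ((real \<Rightarrow> real) \<Rightarrow> real) \<Rightarrow> bool" where
  "fully_symmetric_functional E \<phi> \<longleftrightarrow>
     (\<forall>x\<in>E. \<forall>y\<in>E. (AE t in unit_interval_measure. 0 \<le> x t) \<and>
                    (AE t in unit_interval_measure. 0 \<le> y t) \<and> y \<prec>\<prec> x \<longrightarrow> \<phi> y \<le> \<phi> x)"

text \<open>
  A fully symmetric space other than the null space contains \<^term>\<open>Linf\<close>; the intersection with
  \<open>E\<close> only matters for the null space.
\<close>
definition singular_functional ::
    "(real \<Rightarrow> real) set \<Rightarrow> ((real \<Rightarrow> real) \<Rightarrow> real) \<Rightarrow> bool" where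
  "singular_functional E \<phi> \<longleftrightarrow> (\<forall>f \<in> E \<inter> (L1 \<inter> Linf). \<phi> f = 0)"

end

theory Submission
  imports Defs
begin

text \<open>
  Write \<open>\<Phi> y t\<close> for the integral of the rearrangement of \<open>y\<close> over \<open>(0,t)\<close>, so that \<open>y \<prec>\<prec> x\<close> is
  \<open>\<Phi> y \<le> \<Phi> x\<close>. The functions \<open>x\<^sub>m = (1/m) \<sigma>\<^sub>m (\<mu> x)\<close> satisfy \<open>\<Phi> x\<^sub>m t = \<Phi> x (t/m)\<close> for \<open>t \<le> 1\<close>; hence
  they decrease with \<open>m\<close> for \<open>\<prec>\<prec>\<close>, their norms decrease, and the limit \<open>p\<close> in the theorem exists.

  The functional comes from a Hahn--Banach argument. Call \<open>b\<close> dominated by \<open>a\<close> if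
  \<open>\<Phi> b (t/n) \<le> \<Phi> a t + C t\<close> on \<open>(0,1]\<close> for some \<open>n \<ge> 1\<close> and some constant \<open>C \<ge> 0\<close> in \<open>E\<close>. This
  contains \<open>b \<prec>\<prec> a\<close>, and also the domination of every bounded function in \<open>E\<close> by \<open>0\<close>. So a linear functional that is
  monotone for domination of (almost everywhere) nonnegative functions is both fully symmetric and
  singular. Unlike \<open>\<prec>\<prec>\<close>, domination is compatible with addition, because \<open>\<Phi> (y + z) t\<close> lies below
  \<open>\<Phi> y t + \<Phi> z t\<close> and, for nonnegative \<open>y\<close> and \<open>z\<close>, above \<open>\<Phi> y (t/2) + \<Phi> z (t/2)\<close>. Both estimates
  are read off from the formula \<open>\<Phi> y t = min\<^sub>c (c t + \<integral> (\<bar>y\<bar> - c)\<^sup>+)\<close>, with \<open>c\<close> ranging over the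
  nonnegative reals.

  By the Mazur--Orlicz theorem (\<open>mazur_orlicz_on_cone\<close>) there is a linear \<open>\<phi> \<le> N\<close> that is monotone
  for domination and has \<open>\<phi> x \<ge> p\<close>, provided that \<open>N (c x + a - b) \<ge> c p\<close> for all \<open>c \<ge> 0\<close> and
  all nonnegative \<open>a\<close> that dominate \<open>b\<close>. This is
  \<open>norm_ge_of_dominated_perturbation\<close>, the heart of the proof. With \<open>w = c x + a - b\<close> the two
  estimates give, for some \<open>m \<ge> 2\<close>,
  \<open>c \<Phi> x (r/m) \<le> \<Phi> w r + (\<Phi> b r - \<Phi> b (r/m)) + C r\<close>. Summing this over \<open>r, r/m, ..., r/m^(k-1)\<close>
  makes the bracket telescope, and after division by \<open>k\<close> the contributions of \<open>b\<close> and \<open>C\<close> are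
  \<open>O(1/k)\<close>: the function \<open>c x\<^sub>M\<close> with \<open>M = m^k\<close> is submajorized by a function of norm at most
  \<open>N w + O(1/k)\<close>, while \<open>p \<le> N x\<^sub>M\<close>. Let \<open>k\<close> tend to infinity.

  Finally a nonnegative multiple of \<open>\<phi>\<close> takes the value \<open>p\<close> at \<open>x\<close>, since \<open>0 \<le> p \<le> \<phi> x\<close>.
\<close>

section \<open>Sublinear functionals and the Mazur--Orlicz theorem\<close>

definition function_subspace :: "('a \<Rightarrow> real) set \<Rightarrow> bool" where
  "function_subspace E \<longleftrightarrow> (\<lambda>t. 0) \<in> E \<and>
     (\<forall>f\<in>E. \<forall>g\<in>E. (\<lambda>t. f t + g t) \<in> E) \<and> (\<forall>c. \<forall>f\<in>E. (\<lambda>t. c * f t) \<in> E)"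

definition sublinear_on :: "('a \<Rightarrow> real) set \<Rightarrow> (('a \<Rightarrow> real) \<Rightarrow> real) \<Rightarrow> bool" where
  "sublinear_on E q \<longleftrightarrow>
     (\<forall>f\<in>E. \<forall>g\<in>E. q (\<lambda>t. f t + g t) \<le> q f + q g) \<and>
     (\<forall>c\<ge>0. \<forall>f\<in>E. q (\<lambda>t. c * f t) = c * q f)"

lemma function_subspaceD:
  assumes "function_subspace E"
  shows "(\<lambda>t. 0) \<in> E" "\<And>f g. f \<in> E \<Longrightarrow> g \<in> E \<Longrightarrow> (\<lambda>t. f t + g t) \<in> E"
    "\<And>c f. f \<in> E \<Longrightarrow> (\<lambda>t. c * f t) \<in> E"
  using assms by (simp_all add: function_subspace_def)

lemma sublinear_onD:
  assumes "sublinear_on E q"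
  shows "\<And>f g. f \<in> E \<Longrightarrow> g \<in> E \<Longrightarrow> q (\<lambda>t. f t + g t) \<le> q f + q g"
    "\<And>c f. c \<ge> 0 \<Longrightarrow> f \<in> E \<Longrightarrow> q (\<lambda>t. c * f t) = c * q f"
  using assms by (simp_all add: sublinear_on_def)

text \<open>
  One inequality suffices for positive homogeneity: the opposite one is the same inequality for the
  factor \<open>1/c\<close>.
\<close>
lemma sublinear_onI:
  assumes E: "function_subspace E"
    and add: "\<And>f g. f \<in> E \<Longrightarrow> g \<in> E \<Longrightarrow> q (\<lambda>t. f t + g t) \<le> q f + q g"
    and scale: "\<And>c f. c > 0 \<Longrightarrow> f \<in> E \<Longrightarrow> q (\<lambda>t. c * f t) \<le> c * q f"
    and zero: "q (\<lambda>t. 0) = 0"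
  shows "sublinear_on E q"
proof -
  have "q (\<lambda>t. c * f t) = c * q f" if "c \<ge> 0" "f \<in> E" for c f
  proof (cases "c = 0")
    case False
    with that have c: "c > 0" by simp
    have cf: "(\<lambda>t. c * f t) \<in> E"
      using E that by (simp add: function_subspace_def)
    have "q (\<lambda>t. (1/c) * (c * f t)) \<le> (1/c) * q (\<lambda>t. c * f t)"
      using scale[OF _ cf, of "1/c"] c by simp
    then have "c * q f \<le> q (\<lambda>t. c * f t)"
      using c by (simp add: field_simps)
    then show ?thesis using scale[OF c \<open>f \<in> E\<close>] by simp
  qed (simp add: zero)
  then show ?thesis using add by (simp add: sublinear_on_def)
qed

lemma sublinear_on_zero:
  assumes "function_subspace E" "sublinear_on E q"
  shows "q (\<lambda>t. 0) = 0"
  using sublinear_onD(2)[OF assms(2) order_refl function_subspaceD(1)[OF assms(1)]] by simp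

lemma sublinear_on_minus:
  assumes E: "function_subspace E" and q: "sublinear_on E q" and f: "f \<in> E"
  shows "- q (\<lambda>t. - f t) \<le> q f"
  using sublinear_onD(1)[OF q f function_subspaceD(3)[OF E f, of "-1"]] sublinear_on_zero[OF E q]
  by simp

text \<open>A convex cone of pairs \<open>(k, c)\<close>, to be read as the demands \<open>c \<le> \<phi> k\<close> on a linear functional \<open>\<phi>\<close>.\<close>
definition weighted_cone :: "('a \<Rightarrow> real) set \<Rightarrow> (('a \<Rightarrow> real) \<times> real) set \<Rightarrow> bool" where
  "weighted_cone E G \<longleftrightarrow> (\<forall>k c. (k, c) \<in> G \<longrightarrow> k \<in> E) \<and> ((\<lambda>t. 0), 0) \<in> G \<and>
     (\<forall>k c k' c'. (k, c) \<in> G \<longrightarrow> (k', c') \<in> G \<longrightarrow> ((\<lambda>t. k t + k' t), c + c') \<in> G) \<and>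
     (\<forall>r k c. r > 0 \<longrightarrow> (k, c) \<in> G \<longrightarrow> ((\<lambda>t. r * k t), r * c) \<in> G)"

lemma weighted_coneD:
  assumes "weighted_cone E G"
  shows "\<forall>k c. (k, c) \<in> G \<longrightarrow> k \<in> E" "((\<lambda>t. 0), 0) \<in> G"
    "\<forall>k c k' c'. (k, c) \<in> G \<longrightarrow> (k', c') \<in> G \<longrightarrow> ((\<lambda>t. k t + k' t), c + c') \<in> G"
    "\<forall>r k c. r > 0 \<longrightarrow> (k, c) \<in> G \<longrightarrow> ((\<lambda>t. r * k t), r * c) \<in> G"
  using assms unfolding weighted_cone_def by - (elim conjE, assumption)+

lemma weighted_coneI:
  assumes "\<And>k c. (k, c) \<in> G \<Longrightarrow> k \<in> E" "((\<lambda>t. 0), 0) \<in> G"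
    "\<And>k c k' c'. (k, c) \<in> G \<Longrightarrow> (k', c') \<in> G \<Longrightarrow> ((\<lambda>t. k t + k' t), c + c') \<in> G"
    "\<And>r k c. r > 0 \<Longrightarrow> (k, c) \<in> G \<Longrightarrow> ((\<lambda>t. r * k t), r * c) \<in> G"
  shows "weighted_cone E G"
  unfolding weighted_cone_def by (intro conjI allI impI assms)

text \<open>
  The functional \<open>f \<mapsto> Inf {q (f + k) - c | (k, c) \<in> G}\<close> absorbs the demands of \<open>G\<close> into a sublinear
  functional. It is finite because \<open>c \<le> q k \<le> q (f + k) + q (- f)\<close>. The value \<open>0\<close> outside \<open>E\<close> makes
  functionals on \<open>E\<close> comparable as functions on the whole type.
\<close>
lemma sublinear_on_below_cone:
  fixes q :: "('a \<Rightarrow> real) \<Rightarrow> real"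
  assumes E: "function_subspace E" and q: "sublinear_on E q"
    and cone: "weighted_cone E G"
    and Gle: "\<And>k c. (k, c) \<in> G \<Longrightarrow> c \<le> q k"
  obtains q' where "sublinear_on E q'" "\<forall>f\<in>E. q' f \<le> q f" "\<forall>f. f \<notin> E \<longrightarrow> q' f = 0"
    "\<forall>f k c. f \<in> E \<longrightarrow> (k, c) \<in> G \<longrightarrow> q' f \<le> q (\<lambda>t. f t + k t) - c"
proof -
  note GE = weighted_coneD(1)[OF cone, rule_format] and G0 = weighted_coneD(2)[OF cone]
    and Gadd = weighted_coneD(3)[OF cone, rule_format]
    and Gscale = weighted_coneD(4)[OF cone, rule_format]
  define V where "V f = (\<lambda>(k, c). q (\<lambda>t. f t + k t) - c) ` G" for f
  define q' where "q' f = (if f \<in> E then Inf (V f) else 0)" for f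
  have Eadd: "(\<lambda>t. f t + g t) \<in> E" if "f \<in> E" "g \<in> E" for f g
    using E that by (simp add: function_subspace_def)
  have Escale: "(\<lambda>t. c * f t) \<in> E" if "f \<in> E" for f c
    using E that by (simp add: function_subspace_def)
  have qadd: "q (\<lambda>t. f t + g t) \<le> q f + q g" if "f \<in> E" "g \<in> E" for f g
    using q that by (simp add: sublinear_on_def)
  have qscale: "q (\<lambda>t. c * f t) = c * q f" if "f \<in> E" "c \<ge> 0" for f c
    using q that by (simp add: sublinear_on_def)
  have ne: "V f \<noteq> {}" for f using G0 by (auto simp: V_def)
  have lb: "- q (\<lambda>t. (-1) * f t) \<le> v" if f: "f \<in> E" and "v \<in> V f" for f v
  proof -
    obtain k c where kc: "(k, c) \<in> G" "v = q (\<lambda>t. f t + k t) - c"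
      using \<open>v \<in> V f\<close> by (auto simp: V_def)
    have "q (\<lambda>t. (f t + k t) + (-1) * f t) \<le> q (\<lambda>t. f t + k t) + q (\<lambda>t. (-1) * f t)"
      by (rule qadd[OF Eadd[OF f GE[OF kc(1)]] Escale[OF f]])
    then show ?thesis using Gle[OF kc(1)] kc(2) by (simp add: algebra_simps)
  qed
  have bdd: "bdd_below (V f)" if "f \<in> E" for f
    using lb[OF that] by (rule bdd_belowI)
  have le: "q' f \<le> q (\<lambda>t. f t + k t) - c" if "f \<in> E" "(k, c) \<in> G" for f k c
    unfolding q'_def using that bdd[OF that(1)] by (auto simp: V_def intro!: cInf_lower)
  have ge: "z \<le> q' f" if "f \<in> E" "\<And>k c. (k, c) \<in> G \<Longrightarrow> z \<le> q (\<lambda>t. f t + k t) - c" for f z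
  proof -
    have "z \<le> Inf (V f)"
      by (rule cInf_greatest[OF ne]) (use that(2) in \<open>auto simp: V_def\<close>)
    then show ?thesis using that(1) by (simp add: q'_def)
  qed
  show thesis
  proof (rule that)
    show "sublinear_on E q'"
    proof (rule sublinear_onI[OF E])
      fix f g assume f: "f \<in> E" and g: "g \<in> E"
      have fg: "q' (\<lambda>t. f t + g t) \<le> (q (\<lambda>t. f t + k t) - c) + (q (\<lambda>t. g t + k' t) - c')"
        if "(k, c) \<in> G" "(k', c') \<in> G" for k c k' c'
      proof -
        have "q' (\<lambda>t. f t + g t) \<le> q (\<lambda>t. (f t + g t) + (k t + k' t)) - (c + c')"
          by (rule le[OF Eadd[OF f g] Gadd[OF that]])
        also have "(\<lambda>t. (f t + g t) + (k t + k' t)) = (\<lambda>t. (f t + k t) + (g t + k' t))"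
          by (simp add: algebra_simps)
        also have "q \<dots> \<le> q (\<lambda>t. f t + k t) + q (\<lambda>t. g t + k' t)"
          by (rule qadd) (use f g that GE Eadd in auto)
        finally show ?thesis by simp
      qed
      have "q' (\<lambda>t. f t + g t) - q' f \<le> q' g"
      proof (rule ge[OF g])
        fix k' c' assume G': "(k', c') \<in> G"
        have "q' (\<lambda>t. f t + g t) - (q (\<lambda>t. g t + k' t) - c') \<le> q' f"
          by (rule ge[OF f]) (use fg[OF _ G'] in \<open>simp add: algebra_simps\<close>)
        then show "q' (\<lambda>t. f t + g t) - q' f \<le> q (\<lambda>t. g t + k' t) - c'" by simp
      qed
      then show "q' (\<lambda>t. f t + g t) \<le> q' f + q' g" by simp
    next
      fix c :: real and f assume c: "c > 0" and f: "f \<in> E"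
      have "q' (\<lambda>t. c * f t) / c \<le> q' f"
      proof (rule ge[OF f])
        fix k d assume G: "(k, d) \<in> G"
        have "q' (\<lambda>t. c * f t) \<le> q (\<lambda>t. c * f t + c * k t) - c * d"
          by (rule le[OF Escale[OF f] Gscale[OF c G]])
        also have "(\<lambda>t. c * f t + c * k t) = (\<lambda>t. c * (f t + k t))"
          by (simp add: algebra_simps)
        also have "q \<dots> = c * q (\<lambda>t. f t + k t)"
          by (rule qscale) (use Eadd[OF f GE[OF G]] c in auto)
        finally show "q' (\<lambda>t. c * f t) / c \<le> q (\<lambda>t. f t + k t) - d"
          using c by (simp add: field_simps)
      qed
      then show "q' (\<lambda>t. c * f t) \<le> c * q' f" using c by (simp add: field_simps)
    next
      have 0: "(\<lambda>t. 0) \<in> E" using E by (simp add: function_subspace_def)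
      have "0 \<le> q' (\<lambda>t. 0)"
        by (rule ge[OF 0]) (use Gle in simp)
      then show "q' (\<lambda>t. 0) = 0"
        using le[OF 0 G0] sublinear_on_zero[OF E q] by simp
    qed
    show "\<forall>f\<in>E. q' f \<le> q f"
      using le[OF _ G0] by simp
    show "\<forall>f. f \<notin> E \<longrightarrow> q' f = 0"
      by (simp add: q'_def)
    show "\<forall>f k c. f \<in> E \<longrightarrow> (k, c) \<in> G \<longrightarrow> q' f \<le> q (\<lambda>t. f t + k t) - c"
      by (intro allI impI le)
  qed
qed

definition minimal_sublinear_on :: "('a \<Rightarrow> real) set \<Rightarrow> (('a \<Rightarrow> real) \<Rightarrow> real) \<Rightarrow> bool" where
  "minimal_sublinear_on E m \<longleftrightarrow> sublinear_on E m \<and> (\<forall>f. f \<notin> E \<longrightarrow> m f = 0) \<and>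
     (\<forall>m'. sublinear_on E m' \<longrightarrow> m' \<le> m \<longrightarrow> (\<forall>f. f \<notin> E \<longrightarrow> m' f = 0) \<longrightarrow> m' = m)"

text \<open>
  Zorn's lemma for the reversed pointwise order. The pointwise infimum of a chain is finite since
  each member \<open>a\<close> has \<open>a f \<ge> - a (- f) \<ge> - q (- f)\<close>; it is subadditive because any two members of
  the chain have a common lower bound in it.
\<close>
lemma minimal_sublinear_exists:
  fixes q :: "('a \<Rightarrow> real) \<Rightarrow> real"
  assumes E: "function_subspace E" and q: "sublinear_on E q" and q0: "\<And>f. f \<notin> E \<Longrightarrow> q f = 0"
  obtains m where "minimal_sublinear_on E m" "m \<le> q"
proof -
  define A where "A = {q'. sublinear_on E q' \<and> q' \<le> q \<and> (\<forall>f. f \<notin> E \<longrightarrow> q' f = 0)}"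
  let ?R = "\<lambda>a b :: ('a \<Rightarrow> real) \<Rightarrow> real. b \<le> a"
  have po: "partial_order_on A (relation_of ?R A)"
  proof (rule partial_order_on_relation_ofI)
    show "?R a a" for a by (rule order_refl)
    show "?R a c" if "?R a b" "?R b c" for a b c using that(2,1) by (rule order_trans)
    show "a = b" if "?R a b" "?R b a" for a b using that(2,1) by (rule order_antisym)
  qed
  have "\<exists>u\<in>A. \<forall>a\<in>C. ?R a u" if C: "C \<in> Chains (relation_of ?R A)" for C
  proof (cases "C = {}")
    case True
    have "q \<in> A" using q q0 by (simp add: A_def)
    with True show ?thesis by blast
  next
    case False
    have CA: "C \<subseteq> A" and lin: "\<And>a b. a \<in> C \<Longrightarrow> b \<in> C \<Longrightarrow> a \<le> b \<or> b \<le> a"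
      using C by (auto simp: Chains_def relation_of_def)
    define u where "u f = (INF a\<in>C. a f)" for f
    have sub: "sublinear_on E a" if "a \<in> C" for a using that CA by (auto simp: A_def)
    have lower: "- q (\<lambda>t. - f t) \<le> a f" if "a \<in> C" "f \<in> E" for a f
    proof -
      have "a (\<lambda>t. - f t) \<le> q (\<lambda>t. - f t)" using that CA by (auto simp: A_def le_fun_def)
      then show ?thesis using sublinear_on_minus[OF E sub[OF that(1)] that(2)] by simp
    qed
    have outside: "a f = 0" if "a \<in> C" "f \<notin> E" for a f using that CA by (auto simp: A_def)
    have bdd: "bdd_below ((\<lambda>a. a f) ` C)" for f
    proof (cases "f \<in> E")
      case True
      then show ?thesis using lower by (intro bdd_belowI[of _ "- q (\<lambda>t. - f t)"]) auto
    next
      case False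
      show ?thesis by (intro bdd_belowI2[of _ 0] eq_refl sym[OF outside] False)
    qed
    have le: "u f \<le> a f" if "a \<in> C" for a f
      unfolding u_def by (rule cINF_lower[OF bdd that])
    have ge: "z \<le> u f" if "\<And>a. a \<in> C \<Longrightarrow> z \<le> a f" for z f
      unfolding u_def by (rule cINF_greatest[OF False that])
    have const: "u f = z" if "\<And>a. a \<in> C \<Longrightarrow> a f = z" for f z
    proof -
      have "u f = (INF a\<in>C. z)" unfolding u_def using that by (intro INF_cong) simp_all
      then show ?thesis using False by simp
    qed
    have "sublinear_on E u"
    proof (rule sublinear_onI[OF E])
      fix f g assume f: "f \<in> E" and g: "g \<in> E"
      have fg: "u (\<lambda>t. f t + g t) \<le> a f + b g" if a: "a \<in> C" and b: "b \<in> C" for a b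
      proof -
        obtain d where d: "d \<in> C" "d \<le> a" "d \<le> b" using lin[OF a b] a b by blast
        have "u (\<lambda>t. f t + g t) \<le> d (\<lambda>t. f t + g t)" by (rule le[OF d(1)])
        also have "\<dots> \<le> d f + d g" using sub[OF d(1)] f g by (simp add: sublinear_on_def)
        also have "\<dots> \<le> a f + b g" using d by (intro add_mono) (auto simp: le_fun_def)
        finally show ?thesis .
      qed
      have "u (\<lambda>t. f t + g t) - u f \<le> u g"
      proof (rule ge)
        fix b assume b: "b \<in> C"
        have "u (\<lambda>t. f t + g t) - b g \<le> u f"
          by (rule ge) (use fg[OF _ b] in \<open>simp add: algebra_simps\<close>)
        then show "u (\<lambda>t. f t + g t) - u f \<le> b g" by simp
      qed
      then show "u (\<lambda>t. f t + g t) \<le> u f + u g" by simp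
    next
      fix c :: real and f assume c: "c > 0" and f: "f \<in> E"
      have "u (\<lambda>t. c * f t) / c \<le> u f"
      proof (rule ge)
        fix a assume a: "a \<in> C"
        have "a (\<lambda>t. c * f t) = c * a f" using sub[OF a] c f by (simp add: sublinear_on_def)
        then show "u (\<lambda>t. c * f t) / c \<le> a f"
          using le[OF a, of "\<lambda>t. c * f t"] c by (simp add: field_simps)
      qed
      then show "u (\<lambda>t. c * f t) \<le> c * u f" using c by (simp add: field_simps)
    next
      have "a (\<lambda>t. 0) = 0" if "a \<in> C" for a
        by (rule sublinear_on_zero[OF E sub[OF that]])
      then show "u (\<lambda>t. 0) = 0" by (rule const)
    qed
    moreover have "u \<le> q"
    proof -
      obtain a where a: "a \<in> C" using False by blast
      then have "a \<le> q" using CA by (auto simp: A_def)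
      then have "u f \<le> q f" for f using le[OF a, of f] by (auto simp: le_fun_def intro: order_trans)
      then show ?thesis by (simp add: le_fun_def)
    qed
    moreover have "u f = 0" if "f \<notin> E" for f
      by (rule const[OF outside[OF _ that]])
    ultimately show ?thesis using le by (auto simp: A_def le_fun_def)
  qed
  from predicate_Zorn[OF po this] obtain m
    where m: "m \<in> A" and min: "\<And>a. a \<in> A \<Longrightarrow> a \<le> m \<Longrightarrow> a = m" by blast
  have "m' = m" if "sublinear_on E m'" "m' \<le> m" "\<forall>f. f \<notin> E \<longrightarrow> m' f = 0" for m'
  proof (rule min[OF _ that(2)])
    have "m \<le> q" using m by (simp add: A_def)
    then show "m' \<in> A" using that order_trans[OF that(2)] by (simp add: A_def)
  qed
  with m have "minimal_sublinear_on E m" "m \<le> q"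
    by (simp_all add: A_def minimal_sublinear_on_def)
  then show thesis by (rule that)
qed

text \<open>
  A minimal sublinear functional is not lowered by the ray of demands \<open>r * m g \<le> \<phi> (r * g)\<close>,
  which are consistent with it. So the functional \<open>Inf {m (f + r * g) - r * m g | r \<ge> 0}\<close> is \<open>m\<close> again,
  and \<open>r = 1\<close> gives the claim.
\<close>
lemma minimal_sublinear_superadditive:
  assumes E: "function_subspace E" and min: "minimal_sublinear_on E m"
    and f: "f \<in> E" and g: "g \<in> E"
  shows "m f + m g \<le> m (\<lambda>t. f t + g t)"
proof -
  have m: "sublinear_on E m" and m0: "f \<notin> E \<Longrightarrow> m f = 0" for f
    using min by (simp_all add: minimal_sublinear_on_def)
  define G where "G = {((\<lambda>t. r * g t), r * m g) | r. r \<ge> 0}"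
  have G_iff: "(k, c) \<in> G \<longleftrightarrow> (\<exists>r. r \<ge> 0 \<and> k = (\<lambda>t. r * g t) \<and> c = r * m g)" for k c
    by (simp add: G_def conj_ac)
  have G1: "(g, m g) \<in> G" unfolding G_def by (intro CollectI exI[of _ 1]) simp
  have cone: "weighted_cone E G"
  proof (rule weighted_coneI)
    show "((\<lambda>t. 0), 0) \<in> G" unfolding G_iff by (intro exI[of _ 0]) simp
    show "k \<in> E" if "(k, c) \<in> G" for k c
      using that function_subspaceD(3)[OF E g] by (auto simp: G_iff)
    show "((\<lambda>t. k t + k' t), c + c') \<in> G" if G: "(k, c) \<in> G" and G': "(k', c') \<in> G" for k c k' c'
    proof -
      obtain r where r: "r \<ge> 0 \<and> k = (\<lambda>t. r * g t) \<and> c = r * m g"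
        using G unfolding G_iff ..
      obtain r' where r': "r' \<ge> 0 \<and> k' = (\<lambda>t. r' * g t) \<and> c' = r' * m g"
        using G' unfolding G_iff ..
      show ?thesis unfolding G_iff
        using r r' by (intro exI[of _ "r + r'"]) (simp add: algebra_simps)
    qed
    show "((\<lambda>t. r * k t), r * c) \<in> G" if "r > 0" and G: "(k, c) \<in> G" for r k c
    proof -
      obtain s where s: "s \<ge> 0 \<and> k = (\<lambda>t. s * g t) \<and> c = s * m g"
        using G unfolding G_iff ..
      then show ?thesis unfolding G_iff
        using \<open>r > 0\<close> by (intro exI[of _ "r * s"]) (simp add: algebra_simps)
    qed
  qed
  have below: "c \<le> m k" if "(k, c) \<in> G" for k c
    using that sublinear_onD(2)[OF m _ g] by (auto simp: G_iff)
  obtain q' where q': "sublinear_on E q'" "\<forall>f\<in>E. q' f \<le> m f" "\<forall>f. f \<notin> E \<longrightarrow> q' f = 0"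
    "\<forall>f k c. f \<in> E \<longrightarrow> (k, c) \<in> G \<longrightarrow> q' f \<le> m (\<lambda>t. f t + k t) - c"
    by (rule sublinear_on_below_cone[OF E m cone]) (erule below, rule that)
  have "q' = m"
  proof -
    have "q' f \<le> m f" for f using q'(2,3) m0[of f] by (cases "f \<in> E") simp_all
    then have "q' \<le> m" by (simp add: le_fun_def)
    then show ?thesis using min q'(1,3) by (simp add: minimal_sublinear_on_def)
  qed
  then show ?thesis using q'(4)[rule_format, OF f G1] by simp
qed

text \<open>
  The demands in \<open>G\<close> can be met by a linear functional below \<open>q\<close> as soon as \<open>q\<close> itself meets them:
  a minimal sublinear functional below the one of \<open>sublinear_on_below_cone\<close> is linear, and
  its value at \<open>- k\<close> is at most \<open>- c\<close>.
\<close>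
theorem mazur_orlicz_on_cone:
  fixes q :: "('a \<Rightarrow> real) \<Rightarrow> real"
  assumes E: "function_subspace E" and q: "sublinear_on E q"
    and cone: "weighted_cone E G"
    and Gle: "\<And>k c. (k, c) \<in> G \<Longrightarrow> c \<le> q k"
  obtains \<phi> where "\<And>f g. f \<in> E \<Longrightarrow> g \<in> E \<Longrightarrow> \<phi> (\<lambda>t. f t + g t) = \<phi> f + \<phi> g"
    "\<And>c f. f \<in> E \<Longrightarrow> \<phi> (\<lambda>t. c * f t) = c * \<phi> f"
    "\<And>f. f \<in> E \<Longrightarrow> \<phi> f \<le> q f" "\<And>k c. (k, c) \<in> G \<Longrightarrow> c \<le> \<phi> k"
proof -
  note GE = weighted_coneD(1)[OF cone, rule_format]
  obtain q' where q': "sublinear_on E q'" "\<forall>f\<in>E. q' f \<le> q f" "\<forall>f. f \<notin> E \<longrightarrow> q' f = 0"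
    "\<forall>f k c. f \<in> E \<longrightarrow> (k, c) \<in> G \<longrightarrow> q' f \<le> q (\<lambda>t. f t + k t) - c"
    by (rule sublinear_on_below_cone[OF E q cone]) (erule Gle, rule that)
  obtain m where min: "minimal_sublinear_on E m" and mq: "m \<le> q'"
    by (rule minimal_sublinear_exists[OF E q'(1) q'(3)[rule_format]]) (assumption, rule that)
  have m: "sublinear_on E m" using min by (simp add: minimal_sublinear_on_def)
  have Escale: "(\<lambda>t. c * f t) \<in> E" if "f \<in> E" for f c
    using E that by (simp add: function_subspace_def)
  have add: "m (\<lambda>t. f t + g t) = m f + m g" if "f \<in> E" "g \<in> E" for f g
    using minimal_sublinear_superadditive[OF E min that] sublinear_onD(1)[OF m that]
    by simp
  have neg: "m (\<lambda>t. - f t) = - m f" if "f \<in> E" for f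
    using add[OF that Escale[OF that, of "-1"]] sublinear_on_zero[OF E m] by simp
  show thesis
  proof (rule that)
    show "m (\<lambda>t. f t + g t) = m f + m g" if "f \<in> E" "g \<in> E" for f g
      using add[OF that] .
    show "m (\<lambda>t. c * f t) = c * m f" if "f \<in> E" for c f
    proof (cases "c \<ge> 0")
      case True
      then show ?thesis using m that by (simp add: sublinear_on_def)
    next
      case False
      have "m (\<lambda>t. (- c) * f t) = (- c) * m f"
        by (rule sublinear_onD(2)[OF m]) (use that False in simp_all)
      then show ?thesis using neg[OF Escale[OF that, of c]] by simp
    qed
    show "m f \<le> q f" if "f \<in> E" for f
      using order_trans[OF le_funD[OF mq, of f]] q'(2) that by simp
    show "c \<le> m k" if "(k, c) \<in> G" for k c
    proof -
      note k = GE[OF that]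
      have "m (\<lambda>t. - k t) \<le> q' (\<lambda>t. - k t)" using mq by (simp add: le_fun_def)
      also have "\<dots> \<le> q (\<lambda>t. - k t + k t) - c"
        using q'(4)[rule_format, OF _ that, of "\<lambda>t. - k t"] Escale[OF k, of "-1"] by simp
      finally show ?thesis using neg[OF k] sublinear_on_zero[OF E q] by simp
    qed
  qed
qed

section \<open>Distribution functions and decreasing rearrangements\<close>

text \<open>
  Fubini's theorem for the region \<open>c \<le> u < f x\<close>. The truncation of \<^const>\<open>ennreal\<close> at \<open>0\<close> turns
  \<open>f x - c\<close> into the positive part.
\<close>
lemma nn_integral_layer_cake:
  fixes f :: "'a \<Rightarrow> real"
  assumes "sigma_finite_measure M" and f[measurable]: "f \<in> borel_measurable M"
  shows "(\<integral>\<^sup>+x. ennreal (f x - c) \<partial>M) = (\<integral>\<^sup>+u\<in>{c..}. emeasure M {x\<in>space M. u < f x} \<partial>lborel)"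
proof -
  interpret M: sigma_finite_measure M by fact
  interpret pair_sigma_finite M lborel ..
  have "(\<integral>\<^sup>+x. ennreal (f x - c) \<partial>M)
      = (\<integral>\<^sup>+x. (\<integral>\<^sup>+u. (if c \<le> u \<and> u < f x then 1 else 0) \<partial>lborel) \<partial>M)"
  proof (intro nn_integral_cong)
    fix x
    have "(\<integral>\<^sup>+u. (if c \<le> u \<and> u < f x then 1 else 0) \<partial>lborel)
        = (\<integral>\<^sup>+u. indicator {c..<f x} u \<partial>lborel)"
      by (intro nn_integral_cong) (simp add: indicator_def)
    also have "\<dots> = ennreal (f x - c)"
      by (cases "c \<le> f x") (simp_all add: ennreal_neg)
    finally show "ennreal (f x - c) = (\<integral>\<^sup>+u. (if c \<le> u \<and> u < f x then 1 else 0) \<partial>lborel)" by simp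
  qed
  also have "\<dots> = (\<integral>\<^sup>+u. (\<integral>\<^sup>+x. (if c \<le> u \<and> u < f x then 1 else 0) \<partial>M) \<partial>lborel)"
    by (rule Fubini'[symmetric]) simp
  also have "\<dots> = (\<integral>\<^sup>+u\<in>{c..}. emeasure M {x\<in>space M. u < f x} \<partial>lborel)"
  proof (intro nn_integral_cong)
    fix u :: real
    have "(\<integral>\<^sup>+x. (if c \<le> u \<and> u < f x then 1 else 0) \<partial>M)
        = (\<integral>\<^sup>+x. indicator {c..} u * indicator {x\<in>space M. u < f x} x \<partial>M)"
      by (intro nn_integral_cong) (simp add: indicator_def)
    also have "\<dots> = indicator {c..} u * emeasure M {x\<in>space M. u < f x}"
      by (subst nn_integral_cmult_indicator) simp_all
    finally show "(\<integral>\<^sup>+x. (if c \<le> u \<and> u < f x then 1 else 0) \<partial>M)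
        = emeasure M {x\<in>space M. u < f x} * indicator {c..} u" by (simp add: mult.commute)
  qed
  finally show ?thesis .
qed

definition dist_fun :: "(real \<Rightarrow> real) \<Rightarrow> real \<Rightarrow> real" where
  "dist_fun y u = measure unit_interval_measure {v \<in> {0<..<1}. u < \<bar>y v\<bar>}"

abbreviation measurable_on_unit :: "(real \<Rightarrow> real) \<Rightarrow> bool" where
  "measurable_on_unit y \<equiv> y \<in> borel_measurable unit_interval_measure"

lemma unit_interval_finite: "finite_measure unit_interval_measure"
  by (rule finite_measure_lebesgue_on) simp

lemma unit_interval_sigma_finite: "sigma_finite_measure unit_interval_measure"
  using unit_interval_finite by (simp add: finite_measure_def)

lemma emeasure_unit_interval: "emeasure unit_interval_measure {0<..<1} = 1"
  by (simp add: emeasure_restrict_space)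

lemma level_set_measurable:
  assumes "measurable_on_unit y"
  shows "{v \<in> {0<..<1}. u < \<bar>y v\<bar>} \<in> sets unit_interval_measure"
proof -
  note assms[measurable]
  have "{v \<in> space unit_interval_measure. u < \<bar>y v\<bar>} \<in> sets unit_interval_measure" by measurable
  then show ?thesis by simp
qed

lemma emeasure_level_set:
  assumes "measurable_on_unit y"
  shows "emeasure unit_interval_measure {v \<in> {0<..<1}. u < \<bar>y v\<bar>} = ennreal (dist_fun y u)"
  unfolding dist_fun_def
  by (rule finite_measure.emeasure_eq_measure[OF unit_interval_finite])

lemma dist_fun_nonneg: "0 \<le> dist_fun y u"
  by (simp add: dist_fun_def)

lemma dist_fun_le_1: "dist_fun y u \<le> 1"
proof -
  have "dist_fun y u \<le> measure unit_interval_measure (space unit_interval_measure)"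
    unfolding dist_fun_def by (rule finite_measure.bounded_measure[OF unit_interval_finite])
  also have "\<dots> = 1" using emeasure_unit_interval by (simp add: measure_def)
  finally show ?thesis .
qed

lemma dist_fun_antimono:
  assumes "measurable_on_unit y" "u \<le> v"
  shows "dist_fun y v \<le> dist_fun y u"
  unfolding dist_fun_def
  by (rule finite_measure.finite_measure_mono[OF unit_interval_finite _ level_set_measurable])
     (use assms in auto)

lemma dist_fun_measurable [measurable]:
  assumes "measurable_on_unit y"
  shows "dist_fun y \<in> borel_measurable borel"
proof -
  have "(\<lambda>u. - dist_fun y u) \<in> borel_measurable borel"
    by (rule borel_measurable_mono) (simp add: mono_def dist_fun_antimono[OF assms])
  then have "(\<lambda>u. - (- dist_fun y u)) \<in> borel_measurable borel" by (rule borel_measurable_uminus)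
  then show ?thesis by simp
qed

text \<open>Right continuity of the distribution function, by continuity of the measure from below.\<close>
lemma dist_fun_right_cont:
  assumes y: "measurable_on_unit y" and le: "\<And>s. u < s \<Longrightarrow> dist_fun y s \<le> t"
  shows "dist_fun y u \<le> t"
proof -
  let ?A = "\<lambda>n. {v \<in> {0<..<1}. u + 1 / real (Suc n) < \<bar>y v\<bar>}"
  have "(\<lambda>n. measure unit_interval_measure (?A n)) \<longlonglongrightarrow> measure unit_interval_measure (\<Union>n. ?A n)"
  proof (rule finite_measure.finite_Lim_measure_incseq[OF unit_interval_finite])
    show "range ?A \<subseteq> sets unit_interval_measure" using level_set_measurable[OF y] by blast
    show "incseq ?A"
    proof (rule incseq_SucI, rule subsetI)
      fix n x assume "x \<in> ?A n"
      moreover have "1 / real (Suc (Suc n)) \<le> 1 / real (Suc n)" by (simp add: field_simps)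
      ultimately show "x \<in> ?A (Suc n)" by simp
    qed
  qed
  moreover have "(\<Union>n. ?A n) = {v \<in> {0<..<1}. u < \<bar>y v\<bar>}"
  proof (intro equalityI subsetI)
    fix v assume v: "v \<in> {v \<in> {0<..<1}. u < \<bar>y v\<bar>}"
    then have "0 < \<bar>y v\<bar> - u" by simp
    then obtain n where "inverse (real (Suc n)) < \<bar>y v\<bar> - u" using reals_Archimedean by blast
    then have "v \<in> ?A n" using v by (simp add: inverse_eq_divide)
    then show "v \<in> (\<Union>n. ?A n)" by blast
  next
    fix v assume "v \<in> (\<Union>n. ?A n)"
    then obtain n where "v \<in> ?A n" by blast
    moreover have "0 < 1 / real (Suc n)" by simp
    ultimately have "v \<in> {0<..<1}" "u < \<bar>y v\<bar>" by (blast, simp only: mem_Collect_eq, linarith)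
    then show "v \<in> {v \<in> {0<..<1}. u < \<bar>y v\<bar>}" by simp
  qed
  ultimately have "(\<lambda>n. dist_fun y (u + 1 / real (Suc n))) \<longlonglongrightarrow> dist_fun y u"
    by (simp add: dist_fun_def)
  then show ?thesis
    by (rule LIMSEQ_le_const2) (intro exI[of _ 0] allI impI le, simp)
qed

text \<open>
  The set in the definition of the rearrangement is nonempty for \<open>t > 0\<close>, by continuity of the finite
  measure from above.
\<close>
lemma dist_fun_small:
  assumes y: "measurable_on_unit y" and t: "0 < t"
  obtains s where "0 \<le> s" "dist_fun y s \<le> t"
proof -
  let ?A = "\<lambda>n. {v \<in> {0<..<1}. real n < \<bar>y v\<bar>}"
  have "(\<lambda>n. measure unit_interval_measure (?A n)) \<longlonglongrightarrow> measure unit_interval_measure (\<Inter>n. ?A n)"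
  proof (rule finite_measure.finite_Lim_measure_decseq[OF unit_interval_finite])
    show "range ?A \<subseteq> sets unit_interval_measure" using level_set_measurable[OF y] by blast
    show "decseq ?A" by (auto simp: decseq_def)
  qed
  moreover have "(\<Inter>n. ?A n) = {}"
  proof -
    have "\<exists>n. v \<notin> ?A n" for v
      using real_arch_simple[of "\<bar>y v\<bar>"] by (auto simp: not_less)
    then show ?thesis by blast
  qed
  ultimately have "(\<lambda>n. dist_fun y (real n)) \<longlonglongrightarrow> 0" by (simp add: dist_fun_def)
  then have "\<forall>\<^sub>F n in sequentially. dist_fun y (real n) < t"
    using t by (rule order_tendstoD)
  then obtain n where "dist_fun y (real n) < t" by (auto simp: eventually_sequentially)
  then show thesis using that[of "real n"] by simp
qed

lemma rearrangement_eq: "rearrangement y t = Inf {s. 0 \<le> s \<and> dist_fun y s \<le> t}"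
  by (simp add: rearrangement_def dist_fun_def)

lemma rearrangement_nonneg:
  assumes "measurable_on_unit y" "0 < t"
  shows "0 \<le> rearrangement y t"
proof -
  obtain s where "0 \<le> s" "dist_fun y s \<le> t" using dist_fun_small[OF assms] .
  then have "{s. 0 \<le> s \<and> dist_fun y s \<le> t} \<noteq> {}" by blast
  then show ?thesis unfolding rearrangement_eq by (rule cInf_greatest) simp
qed

text \<open>
  The Galois connection between rearrangement and distribution function. Right continuity says that
  the infimum defining the rearrangement is attained.
\<close>
lemma rearrangement_le_iff:
  assumes y: "measurable_on_unit y" and t: "0 < t" and u: "0 \<le> u"
  shows "rearrangement y t \<le> u \<longleftrightarrow> dist_fun y u \<le> t"
proof
  let ?S = "{s. 0 \<le> s \<and> dist_fun y s \<le> t}"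
  have bdd: "bdd_below ?S" by (rule bdd_belowI[of _ 0]) simp
  show "rearrangement y t \<le> u" if "dist_fun y u \<le> t"
    unfolding rearrangement_eq by (rule cInf_lower[OF _ bdd]) (use that u in simp)
  show "dist_fun y u \<le> t" if le: "rearrangement y t \<le> u"
  proof (rule dist_fun_right_cont[OF y])
    fix s assume "u < s"
    obtain s0 where "0 \<le> s0" "dist_fun y s0 \<le> t" using dist_fun_small[OF y t] .
    then have ne: "?S \<noteq> {}" by blast
    have "Inf ?S < s" using le \<open>u < s\<close> by (simp add: rearrangement_eq)
    from cInf_lessD[OF ne this] obtain s' where "dist_fun y s' \<le> t" "s' \<le> s" by auto
    then show "dist_fun y s \<le> t" using dist_fun_antimono[OF y \<open>s' \<le> s\<close>] by simp
  qed
qed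

lemma rearrangement_superlevel:
  assumes y: "measurable_on_unit y"
  shows "{s. 0 < s \<and> u < rearrangement y s} = (if u < 0 then {0<..} else {0<..<dist_fun y u})"
proof (cases "u < 0")
  case True
  then have "u < rearrangement y s" if "0 < s" for s using rearrangement_nonneg[OF y that] by simp
  with True show ?thesis by auto
next
  case False
  then have "u < rearrangement y s \<longleftrightarrow> s < dist_fun y u" if "0 < s" for s
    using rearrangement_le_iff[OF y that, of u] by (simp add: not_le[symmetric])
  with False show ?thesis by auto
qed

text \<open>The rearrangement is cut off at \<open>0\<close>, where it may take an unspecified value.\<close>
lemma rearrangement_borel:
  assumes y: "measurable_on_unit y"
  shows "(\<lambda>s. if 0 < s then rearrangement y s else 0) \<in> borel_measurable borel"
proof (rule borel_measurableI_greater)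
  fix u
  have "{s \<in> space borel. u < (if 0 < s then rearrangement y s else 0)}
      = {s. 0 < s \<and> u < rearrangement y s} \<union> (if u < 0 then {..0} else {})"
    by (cases "u < 0") auto
  also have "\<dots> \<in> sets borel" unfolding rearrangement_superlevel[OF y] by simp
  finally show "{s \<in> space borel. u < (if 0 < s then rearrangement y s else 0)} \<in> sets borel" .
qed


section \<open>Integrals of the rearrangement as a minimum over truncation levels\<close>

definition cumulative :: "(real \<Rightarrow> real) \<Rightarrow> real \<Rightarrow> ennreal" where
  "cumulative y t = (\<integral>\<^sup>+s\<in>{0..t}. ennreal (rearrangement y s) \<partial>lborel)"

lemma submajorized_iff_cumulative: "y \<prec>\<prec> x \<longleftrightarrow> (\<forall>t\<ge>0. cumulative y t \<le> cumulative x t)"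
  by (simp add: submajorized_def cumulative_def)

text \<open>
  The rearrangement enters only through its superlevel sets, which are the intervals from \<open>0\<close> to
  \<^term>\<open>dist_fun y u\<close>.
\<close>
lemma cumulative_layer_cake:
  assumes y: "measurable_on_unit y" and t: "0 < t"
  shows "cumulative y t = (\<integral>\<^sup>+u\<in>{0..}. ennreal (min t (dist_fun y u)) \<partial>lborel)"
proof -
  define f where "f s = (if 0 < s \<and> s \<le> t then rearrangement y s else 0)" for s
  have "f = (\<lambda>s. indicator {..t} s * (if 0 < s then rearrangement y s else 0))"
    by (auto simp: f_def indicator_def)
  moreover have "(\<lambda>s. indicator {..t} s * (if 0 < s then rearrangement y s else 0)) \<in> borel_measurable borel"
    by (intro borel_measurable_times rearrangement_borel[OF y]) simp
  ultimately have f: "f \<in> borel_measurable lborel" by simp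
  have "cumulative y t = (\<integral>\<^sup>+s. ennreal (f s - 0) \<partial>lborel)"
    unfolding cumulative_def
  proof (rule nn_integral_cong_AE)
    have "AE s in lborel. s \<noteq> (0::real)" by (rule AE_lborel_singleton)
    then show "AE s in lborel. ennreal (rearrangement y s) * indicator {0..t} s = ennreal (f s - 0)"
      by eventually_elim (auto simp: f_def indicator_def)
  qed
  also have "\<dots> = (\<integral>\<^sup>+u\<in>{0..}. emeasure lborel {s \<in> space lborel. u < f s} \<partial>lborel)"
    by (rule nn_integral_layer_cake[OF _ f]) (rule sigma_finite_lborel)
  also have "\<dots> = (\<integral>\<^sup>+u\<in>{0..}. ennreal (min t (dist_fun y u)) \<partial>lborel)"
  proof (rule nn_integral_cong)
    fix u :: real
    have "emeasure lborel {s. u < f s} = ennreal (min t (dist_fun y u))" if "0 \<le> u"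
    proof -
      have "{s. u < f s} = {s. 0 < s \<and> u < rearrangement y s} \<inter> {..t}"
        using that by (auto simp: f_def)
      also have "\<dots> = {0<..<dist_fun y u} \<inter> {..t}"
        using that by (simp add: rearrangement_superlevel[OF y])
      also have "\<dots> = (if dist_fun y u \<le> t then {0<..<dist_fun y u} else {0<..t})" by auto
      finally show ?thesis using t dist_fun_nonneg[of y u] by (simp add: min_def)
    qed
    then show "emeasure lborel {s \<in> space lborel. u < f s} * indicator {0..} u
        = ennreal (min t (dist_fun y u)) * indicator {0..} u"
      by (auto simp: indicator_def)
  qed
  finally show ?thesis .
qed

text \<open>Since \<^const>\<open>ennreal\<close> truncates at \<open>0\<close>, this is the integral of the positive part \<open>(\<bar>y\<bar> - c)\<^sup>+\<close>.\<close>
definition excess :: "(real \<Rightarrow> real) \<Rightarrow> real \<Rightarrow> ennreal" where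
  "excess y c = (\<integral>\<^sup>+v. ennreal (\<bar>y v\<bar> - c) \<partial>unit_interval_measure)"

lemma excess_layer_cake:
  assumes y: "measurable_on_unit y"
  shows "excess y c = (\<integral>\<^sup>+u\<in>{c..}. ennreal (dist_fun y u) \<partial>lborel)"
  unfolding excess_def
  using nn_integral_layer_cake[OF unit_interval_sigma_finite borel_measurable_abs[OF y], of c]
  by (simp add: emeasure_level_set[OF y, simplified])

lemma cumulative_split:
  assumes y: "measurable_on_unit y" and t: "0 < t" and c: "0 \<le> c"
  shows "cumulative y t = (\<integral>\<^sup>+u\<in>{0..<c}. ennreal (min t (dist_fun y u)) \<partial>lborel)
    + (\<integral>\<^sup>+u\<in>{c..}. ennreal (min t (dist_fun y u)) \<partial>lborel)"
proof -
  note dist_fun_measurable[OF y, measurable]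
  have "cumulative y t = (\<integral>\<^sup>+u. ennreal (min t (dist_fun y u)) * indicator {0..<c} u
      + ennreal (min t (dist_fun y u)) * indicator {c..} u \<partial>lborel)"
    unfolding cumulative_layer_cake[OF y t]
    by (rule nn_integral_cong) (use c in \<open>auto simp: indicator_def\<close>)
  also have "\<dots> = (\<integral>\<^sup>+u\<in>{0..<c}. ennreal (min t (dist_fun y u)) \<partial>lborel)
    + (\<integral>\<^sup>+u\<in>{c..}. ennreal (min t (dist_fun y u)) \<partial>lborel)"
    by (rule nn_integral_add) measurable
  finally show ?thesis .
qed

lemma nn_integral_const_level:
  assumes "0 \<le> c"
  shows "(\<integral>\<^sup>+u\<in>{0..<c}. ennreal t \<partial>lborel) = ennreal t * ennreal (c::real)"
  using assms by (subst nn_integral_cmult_indicator) simp_all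

text \<open>
  One half of the formula \<open>\<Phi> y t = min\<^sub>c (c t + \<integral> (\<bar>y\<bar> - c)\<^sup>+)\<close>: in the layer cake integral, bound
  \<open>min t (dist_fun y u)\<close> by \<open>t\<close> below the level \<open>c\<close> and by \<open>dist_fun y u\<close> above it.
\<close>
lemma cumulative_le_excess:
  assumes y: "measurable_on_unit y" and t: "0 < t" and c: "0 \<le> c"
  shows "cumulative y t \<le> ennreal (c * t) + excess y c"
proof -
  have "(\<integral>\<^sup>+u\<in>{0..<c}. ennreal (min t (dist_fun y u)) \<partial>lborel) \<le> (\<integral>\<^sup>+u\<in>{0..<c}. ennreal t \<partial>lborel)"
    by (intro nn_integral_mono) (auto simp: indicator_def intro: ennreal_leI)
  also have "\<dots> = ennreal (c * t)"
    using c t by (simp add: nn_integral_const_level ennreal_mult mult.commute)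
  finally have "(\<integral>\<^sup>+u\<in>{0..<c}. ennreal (min t (dist_fun y u)) \<partial>lborel) \<le> ennreal (c * t)" .
  moreover have "(\<integral>\<^sup>+u\<in>{c..}. ennreal (min t (dist_fun y u)) \<partial>lborel) \<le> excess y c"
    unfolding excess_layer_cake[OF y]
    by (intro nn_integral_mono) (auto simp: indicator_def intro: ennreal_leI)
  ultimately show ?thesis unfolding cumulative_split[OF y t c] by (rule add_mono)
qed

text \<open>The minimum is attained at the level \<open>c = \<mu>(t, y)\<close>, where both bounds become equalities.\<close>
lemma cumulative_eq_excess:
  assumes y: "measurable_on_unit y" and t: "0 < t"
  obtains c where "0 \<le> c" "cumulative y t = ennreal (c * t) + excess y c"
proof -
  define c where "c = rearrangement y t"
  have c: "0 \<le> c" unfolding c_def by (rule rearrangement_nonneg[OF y t])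
  have below: "t < dist_fun y u" if "0 \<le> u" "u < c" for u
    using rearrangement_le_iff[OF y t that(1)] that(2) by (simp add: c_def not_le[symmetric])
  have above: "dist_fun y u \<le> t" if "c \<le> u" for u
    using rearrangement_le_iff[OF y t, of u] that c by (simp add: c_def)
  have "(\<integral>\<^sup>+u\<in>{0..<c}. ennreal (min t (dist_fun y u)) \<partial>lborel) = (\<integral>\<^sup>+u\<in>{0..<c}. ennreal t \<partial>lborel)"
    by (intro nn_integral_cong) (use below in \<open>force simp: indicator_def min_def\<close>)
  also have "\<dots> = ennreal (c * t)"
    using c t by (simp add: nn_integral_const_level ennreal_mult mult.commute)
  finally have "(\<integral>\<^sup>+u\<in>{0..<c}. ennreal (min t (dist_fun y u)) \<partial>lborel) = ennreal (c * t)" .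
  moreover have "(\<integral>\<^sup>+u\<in>{c..}. ennreal (min t (dist_fun y u)) \<partial>lborel) = excess y c"
    unfolding excess_layer_cake[OF y]
    by (intro nn_integral_cong) (use above in \<open>auto simp: indicator_def min_absorb2\<close>)
  ultimately have "cumulative y t = ennreal (c * t) + excess y c"
    unfolding cumulative_split[OF y t c] by simp
  with c show thesis by (rule that)
qed

text \<open>Add the optimal levels: \<open>(\<bar>y + z\<bar> - c - d)\<^sup>+ \<le> (\<bar>y\<bar> - c)\<^sup>+ + (\<bar>z\<bar> - d)\<^sup>+\<close>.\<close>
lemma cumulative_add_le:
  assumes y: "measurable_on_unit y" and z: "measurable_on_unit z" and t: "0 < t"
  shows "cumulative (\<lambda>v. y v + z v) t \<le> cumulative y t + cumulative z t"
proof -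
  note y[measurable] z[measurable]
  obtain c where c: "0 \<le> c" "cumulative y t = ennreal (c * t) + excess y c"
    using cumulative_eq_excess[OF y t] .
  obtain d where d: "0 \<le> d" "cumulative z t = ennreal (d * t) + excess z d"
    using cumulative_eq_excess[OF z t] .
  have "cumulative (\<lambda>v. y v + z v) t \<le> ennreal ((c + d) * t) + excess (\<lambda>v. y v + z v) (c + d)"
    by (rule cumulative_le_excess) (use t c d in simp_all)
  also have "excess (\<lambda>v. y v + z v) (c + d)
      \<le> (\<integral>\<^sup>+v. ennreal (\<bar>y v\<bar> - c) + ennreal (\<bar>z v\<bar> - d) \<partial>unit_interval_measure)"
    unfolding excess_def
  proof (rule nn_integral_mono)
    fix v
    have "ennreal (\<bar>y v + z v\<bar> - (c + d)) \<le> ennreal (max 0 (\<bar>y v\<bar> - c) + max 0 (\<bar>z v\<bar> - d))"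
      by (rule ennreal_leI) linarith
    also have "\<dots> = ennreal (\<bar>y v\<bar> - c) + ennreal (\<bar>z v\<bar> - d)"
      by (subst ennreal_plus) (simp_all add: max_def ennreal_neg)
    finally show "ennreal (\<bar>y v + z v\<bar> - (c + d)) \<le> ennreal (\<bar>y v\<bar> - c) + ennreal (\<bar>z v\<bar> - d)" .
  qed
  also have "\<dots> = excess y c + excess z d"
    unfolding excess_def by (rule nn_integral_add) measurable
  also have "ennreal ((c + d) * t) = ennreal (c * t) + ennreal (d * t)"
    using c d t by (simp add: distrib_right)
  finally show ?thesis using c(2) d(2) by (simp add: ac_simps add_left_mono)
qed

text \<open>
  A partial converse at the price of adding the arguments. Use the optimal level \<open>c\<close> of the sum for
  both functions: for nonnegative values \<open>(y - c)\<^sup>+ + (z - c)\<^sup>+ \<le> (y + z - c)\<^sup>+\<close>.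
\<close>
lemma cumulative_add_ge:
  assumes y: "measurable_on_unit y" and z: "measurable_on_unit z"
    and y0: "AE v in unit_interval_measure. 0 \<le> y v"
    and z0: "AE v in unit_interval_measure. 0 \<le> z v"
    and s: "0 < s" and t: "0 < t"
  shows "cumulative y s + cumulative z t \<le> cumulative (\<lambda>v. y v + z v) (s + t)"
proof -
  note y[measurable] z[measurable]
  obtain c where c: "0 \<le> c"
    "cumulative (\<lambda>v. y v + z v) (s + t) = ennreal (c * (s + t)) + excess (\<lambda>v. y v + z v) c"
    using cumulative_eq_excess[of "\<lambda>v. y v + z v" "s + t"] s t by auto
  have "cumulative y s + cumulative z t
      \<le> (ennreal (c * s) + excess y c) + (ennreal (c * t) + excess z c)"
    by (intro add_mono cumulative_le_excess y z s t c)
  also have "\<dots> = ennreal (c * (s + t)) + (excess y c + excess z c)"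
    using c s t by (simp add: distrib_left ac_simps)
  also have "excess y c + excess z c
      = (\<integral>\<^sup>+v. ennreal (\<bar>y v\<bar> - c) + ennreal (\<bar>z v\<bar> - c) \<partial>unit_interval_measure)"
    unfolding excess_def by (rule nn_integral_add[symmetric]) measurable
  also have "\<dots> \<le> excess (\<lambda>v. y v + z v) c"
    unfolding excess_def
  proof (rule nn_integral_mono_AE)
    show "AE v in unit_interval_measure.
        ennreal (\<bar>y v\<bar> - c) + ennreal (\<bar>z v\<bar> - c) \<le> ennreal (\<bar>y v + z v\<bar> - c)"
      using y0 z0
    proof eventually_elim
      case (elim v)
      have "ennreal (\<bar>y v\<bar> - c) + ennreal (\<bar>z v\<bar> - c)
          = ennreal (max 0 (\<bar>y v\<bar> - c) + max 0 (\<bar>z v\<bar> - c))"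
        by (subst ennreal_plus) (simp_all add: max_def ennreal_neg)
      also have "\<dots> \<le> ennreal (max 0 (\<bar>y v + z v\<bar> - c))"
        by (rule ennreal_leI) (use elim c in linarith)
      finally show ?case by (simp add: max_def ennreal_neg split: if_splits)
    qed
  qed
  finally show ?thesis using c(2) by (simp add: add_left_mono)
qed

section \<open>Submajorization through the integrals of the rearrangement\<close>

lemma cumulative_mono: "s \<le> t \<Longrightarrow> cumulative y s \<le> cumulative y t"
  unfolding cumulative_def by (intro nn_integral_mono) (auto simp: indicator_def)

lemma cumulative_0: "cumulative y 0 = 0"
proof -
  have "cumulative y 0 = (\<integral>\<^sup>+s. 0 \<partial>(lborel :: real measure))"
    unfolding cumulative_def
  proof (rule nn_integral_cong_AE)
    have "AE s in lborel. s \<noteq> (0::real)" by (rule AE_lborel_singleton)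
    then show "AE s in lborel. ennreal (rearrangement y s) * indicator {0..0} s = 0"
      by eventually_elim (simp add: indicator_def)
  qed
  then show ?thesis by simp
qed

lemma cumulative_beyond_1:
  assumes y: "measurable_on_unit y" and t: "1 \<le> t"
  shows "cumulative y t = cumulative y 1"
proof -
  have "min t (dist_fun y u) = min 1 (dist_fun y u)" for u
    using dist_fun_le_1[of y u] t by (simp add: min_def)
  then show ?thesis using cumulative_layer_cake[OF y, of t] cumulative_layer_cake[OF y, of 1] t by simp
qed

text \<open>
  Beyond \<open>1\<close> the integrals are constant, since rearrangements of functions on \<open>(0,1)\<close> vanish there.
\<close>
lemma submajorizedI:
  assumes y: "measurable_on_unit y" and x: "measurable_on_unit x"
    and le: "\<And>t. 0 < t \<Longrightarrow> t \<le> 1 \<Longrightarrow> cumulative y t \<le> cumulative x t"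
  shows "y \<prec>\<prec> x"
  unfolding submajorized_iff_cumulative
proof (intro allI impI)
  fix t :: real assume "0 \<le> t"
  then consider "t = 0" | "0 < t" "t \<le> 1" | "1 \<le> t" by linarith
  then show "cumulative y t \<le> cumulative x t"
    using le[of t] le[of 1] cumulative_beyond_1[OF y, of t] cumulative_beyond_1[OF x, of t]
    by cases (simp_all add: cumulative_0)
qed

text \<open>The integral of a decreasing function is concave, so it lies above its chord.\<close>
lemma cumulative_ge_linear:
  assumes y: "measurable_on_unit y" and t: "0 < t" "t \<le> 1"
  shows "ennreal t * cumulative y 1 \<le> cumulative y t"
proof -
  note dist_fun_measurable[OF y, measurable]
  have "ennreal t * cumulative y 1
      = (\<integral>\<^sup>+u. ennreal t * (ennreal (min 1 (dist_fun y u)) * indicator {0..} u) \<partial>lborel)"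
    unfolding cumulative_layer_cake[OF y zero_less_one]
    by (rule nn_integral_cmult[symmetric]) measurable
  also have "\<dots> \<le> (\<integral>\<^sup>+u\<in>{0..}. ennreal (min t (dist_fun y u)) \<partial>lborel)"
  proof (rule nn_integral_mono)
    fix u
    have "t * min 1 (dist_fun y u) \<le> min t (dist_fun y u)"
    proof -
      have "t * min 1 (dist_fun y u) \<le> t * 1" using t by (intro mult_left_mono) simp_all
      moreover have "t * min 1 (dist_fun y u) \<le> 1 * dist_fun y u"
        using t dist_fun_nonneg[of y u] by (intro mult_mono) simp_all
      ultimately show ?thesis by simp
    qed
    then have "ennreal t * ennreal (min 1 (dist_fun y u)) \<le> ennreal (min t (dist_fun y u))"
      using t dist_fun_nonneg[of y u] by (subst ennreal_mult[symmetric]) (auto intro: ennreal_leI)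
    then show "ennreal t * (ennreal (min 1 (dist_fun y u)) * indicator {0..} u)
        \<le> ennreal (min t (dist_fun y u)) * indicator {0..} u"
      by (auto simp: indicator_def)
  qed
  also have "\<dots> = cumulative y t" by (rule cumulative_layer_cake[OF y t(1), symmetric])
  finally show ?thesis .
qed

text \<open>Rescaling the level \<open>c\<close> gives one inequality; the factor \<open>1/r\<close> gives the other.\<close>
lemma cumulative_scale:
  assumes y: "measurable_on_unit y" and t: "0 < t" and r: "0 < r"
  shows "cumulative (\<lambda>v. r * y v) t = ennreal r * cumulative y t"
proof -
  have le: "cumulative (\<lambda>v. r * y v) t \<le> ennreal r * cumulative y t"
    if y: "measurable_on_unit y" and r: "0 < r" for y r
  proof -
    note y[measurable]
    obtain c where c: "0 \<le> c" "cumulative y t = ennreal (c * t) + excess y c"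
      using cumulative_eq_excess[OF y t] .
    have "cumulative (\<lambda>v. r * y v) t \<le> ennreal ((r * c) * t) + excess (\<lambda>v. r * y v) (r * c)"
      by (rule cumulative_le_excess) (use r c t in simp_all)
    also have "excess (\<lambda>v. r * y v) (r * c)
        = (\<integral>\<^sup>+v. ennreal r * ennreal (\<bar>y v\<bar> - c) \<partial>unit_interval_measure)"
      unfolding excess_def
    proof (rule nn_integral_cong)
      fix v
      have "\<bar>r * y v\<bar> - r * c = r * (\<bar>y v\<bar> - c)" using r by (simp add: abs_mult algebra_simps)
      then show "ennreal (\<bar>r * y v\<bar> - r * c) = ennreal r * ennreal (\<bar>y v\<bar> - c)"
        using r by (simp add: ennreal_mult')
    qed
    also have "\<dots> = ennreal r * excess y c"
      unfolding excess_def by (rule nn_integral_cmult) measurable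
    also have "ennreal ((r * c) * t) = ennreal r * ennreal (c * t)"
      using r by (simp add: ennreal_mult'[symmetric] mult.assoc)
    finally show ?thesis by (simp add: c(2) distrib_left)
  qed
  note y[measurable]
  have "ennreal r * cumulative (\<lambda>v. (1/r) * (r * y v)) t
      \<le> ennreal r * (ennreal (1/r) * cumulative (\<lambda>v. r * y v) t)"
    by (intro mult_left_mono le) (use r in simp_all)
  also have "\<dots> = cumulative (\<lambda>v. r * y v) t"
    using r by (simp add: mult.assoc[symmetric] ennreal_mult'[symmetric])
  finally show ?thesis using le[OF y r] r by simp
qed

lemma cumulative_bounded:
  assumes y: "measurable_on_unit y" and t: "0 < t" and C: "0 \<le> C"
    and le: "AE v in unit_interval_measure. \<bar>y v\<bar> \<le> C"
  shows "cumulative y t \<le> ennreal (C * t)"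
proof -
  have "excess y C = (\<integral>\<^sup>+v. 0 \<partial>unit_interval_measure)"
    unfolding excess_def using le
    by (intro nn_integral_cong_AE) (auto elim!: eventually_mono simp: ennreal_neg)
  then show ?thesis using cumulative_le_excess[OF y t C] by simp
qed

lemma cumulative_1: "measurable_on_unit y \<Longrightarrow> cumulative y 1 = excess y 0"
  unfolding cumulative_layer_cake[OF _ zero_less_one] excess_layer_cake
  by (simp add: min_absorb2 dist_fun_le_1)

lemma L1_iff_cumulative: "y \<in> L1 \<longleftrightarrow> measurable_on_unit y \<and> cumulative y 1 < \<infinity>"
  by (auto simp: L1_def integrable_iff_bounded cumulative_1 excess_def)

lemma L1_measurable: "y \<in> L1 \<Longrightarrow> measurable_on_unit y"
  by (simp add: L1_iff_cumulative)

lemma cumulative_finite: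
  assumes "y \<in> L1"
  shows "cumulative y t < \<infinity>"
proof -
  have y: "measurable_on_unit y" "cumulative y 1 < \<infinity>" using assms by (simp_all add: L1_iff_cumulative)
  have "cumulative y t \<le> cumulative y (max 1 t)" by (rule cumulative_mono) simp
  also have "\<dots> = cumulative y 1" by (rule cumulative_beyond_1[OF y(1)]) simp
  finally show ?thesis using y(2) by (rule le_less_trans)
qed

text \<open>
  Among all sets of measure \<open>t\<close> the initial interval is one competitor for the largest integral of
  \<open>\<bar>h\<bar>\<close>. In terms of the optimal level \<open>c\<close>, this is \<open>h \<le> c + (\<bar>h\<bar> - c)\<^sup>+\<close> integrated over \<open>(0,t)\<close>.
\<close>
lemma initial_integral_le_cumulative:
  assumes h: "measurable_on_unit h" and t: "0 < t" "t \<le> 1"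
  shows "(\<integral>\<^sup>+s\<in>{0..t}. ennreal (h s) \<partial>lborel) \<le> cumulative h t"
proof -
  obtain c where c: "0 \<le> c" "cumulative h t = ennreal (c * t) + excess h c"
    using cumulative_eq_excess[OF h t(1)] .
  note h[measurable]
  let ?I = "\<lambda>s. indicator {0<..<t} s :: ennreal"
  have sub: "{0<..<t} \<inter> {0<..<1} = {0<..<t}" using t by auto
  have "{0<..<t} \<inter> {0<..<1} \<in> sets unit_interval_measure"
    by (subst sets_restrict_space) auto
  then have I: "{0<..<t} \<in> sets unit_interval_measure" by (simp only: sub)
  have It: "emeasure unit_interval_measure {0<..<t} = ennreal t"
    using t by (subst emeasure_restrict_space) auto
  have "(\<integral>\<^sup>+s\<in>{0..t}. ennreal (h s) \<partial>lborel) = (\<integral>\<^sup>+s. (ennreal (h s) * ?I s) * indicator {0<..<1} s \<partial>lborel)"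
  proof (rule nn_integral_cong_AE)
    have "AE s in lborel. s \<noteq> (0::real)" "AE s in lborel. s \<noteq> t" by (rule AE_lborel_singleton)+
    then show "AE s in lborel. ennreal (h s) * indicator {0..t} s
        = (ennreal (h s) * ?I s) * indicator {0<..<1} s"
      by eventually_elim (use t in \<open>auto simp: indicator_def\<close>)
  qed
  also have "\<dots> = (\<integral>\<^sup>+s. (ennreal (h s) * ?I s) * indicator {0<..<1} s \<partial>lebesgue)"
    by (rule nn_integral_completion[symmetric])
  also have "\<dots> = (\<integral>\<^sup>+s. ennreal (h s) * ?I s \<partial>unit_interval_measure)"
    by (rule nn_integral_restrict_space[symmetric]) simp
  also have "\<dots> \<le> (\<integral>\<^sup>+s. ennreal c * ?I s + ennreal (\<bar>h s\<bar> - c) \<partial>unit_interval_measure)"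
  proof (rule nn_integral_mono)
    fix s
    have "ennreal (h s) \<le> ennreal (c + max 0 (\<bar>h s\<bar> - c))" by (rule ennreal_leI) linarith
    also have "\<dots> = ennreal c + ennreal (\<bar>h s\<bar> - c)"
      using c(1) by (subst ennreal_plus) (simp_all add: max_def ennreal_neg)
    finally show "ennreal (h s) * ?I s \<le> ennreal c * ?I s + ennreal (\<bar>h s\<bar> - c)"
      by (simp add: indicator_def)
  qed
  also have "\<dots> = ennreal c * emeasure unit_interval_measure {0<..<t} + excess h c"
    unfolding excess_def using I by (subst nn_integral_add) (simp_all add: nn_integral_cmult_indicator)
  also have "\<dots> = cumulative h t" using c t by (simp add: It ennreal_mult)
  finally show ?thesis .
qed


section \<open>Dilations of the rearrangement\<close>

lemma dilation_rearrangement_measurable: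
  assumes x: "measurable_on_unit x" and m: "0 < m"
  shows "measurable_on_unit (dilation m (rearrangement x))"
proof -
  have "(\<lambda>s. (if 0 < s / real m then rearrangement x (s / real m) else 0)) \<in> borel_measurable borel"
    by (rule measurable_compose[OF _ rearrangement_borel[OF x]]) measurable
  then have "(\<lambda>s. (if 0 < s / real m then rearrangement x (s / real m) else 0))
      \<in> borel_measurable unit_interval_measure"
    by (intro measurable_restrict_space1 measurable_completion) simp
  then show ?thesis
    by (rule measurable_cong[THEN iffD1, rotated]) (use m in \<open>simp add: dilation_def\<close>)
qed

lemma dist_fun_dilation_rearrangement:
  assumes x: "measurable_on_unit x" and m: "0 < m" and u: "0 \<le> u"
  shows "dist_fun (dilation m (rearrangement x)) u = min 1 (real m * dist_fun x u)"
proof -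
  have "{v \<in> {0<..<1}. u < \<bar>dilation m (rearrangement x) v\<bar>}
      = {0<..<min 1 (real m * dist_fun x u)}" (is "?A = ?B")
  proof (rule set_eqI)
    fix v :: real
    have "u < rearrangement x (v / real m) \<longleftrightarrow> v < real m * dist_fun x u" if "0 < v"
    proof -
      have "rearrangement x (v / real m) \<le> u \<longleftrightarrow> dist_fun x u * real m \<le> v"
        using rearrangement_le_iff[OF x, of "v / real m" u] that m u by (simp add: pos_le_divide_eq)
      then show ?thesis by (simp only: not_le[symmetric] mult.commute)
    qed
    moreover have "\<bar>rearrangement x (v / real m)\<bar> = rearrangement x (v / real m)" if "0 < v"
      using rearrangement_nonneg[OF x, of "v / real m"] that m by simp
    ultimately show "v \<in> ?A \<longleftrightarrow> v \<in> ?B" by (auto simp: dilation_def)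
  qed
  then have "dist_fun (dilation m (rearrangement x)) u = measure unit_interval_measure ?B"
    by (simp add: dist_fun_def)
  also have "\<dots> = measure lebesgue ?B"
    by (rule measure_restrict_space) auto
  also have "\<dots> = min 1 (real m * dist_fun x u)"
    using m dist_fun_nonneg[of x u] by simp
  finally show ?thesis .
qed

lemma cumulative_dilation_rearrangement:
  assumes x: "measurable_on_unit x" and m: "0 < m" and t: "0 < t" "t \<le> 1"
  shows "cumulative (dilation m (rearrangement x)) t = ennreal (real m) * cumulative x (t / real m)"
proof -
  note dist_fun_measurable[OF x, measurable]
  have "cumulative (dilation m (rearrangement x)) t
      = (\<integral>\<^sup>+u. ennreal (real m) * (ennreal (min (t / real m) (dist_fun x u)) * indicator {0..} u) \<partial>lborel)"
    unfolding cumulative_layer_cake[OF dilation_rearrangement_measurable[OF x m] t(1)]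
  proof (rule nn_integral_cong)
    fix u :: real
    have "min t (min 1 (real m * dist_fun x u)) = real m * min (t / real m) (dist_fun x u)"
      using t m by (auto simp: min_def field_simps)
    then show "ennreal (min t (dist_fun (dilation m (rearrangement x)) u)) * indicator {0..} u
        = ennreal (real m) * (ennreal (min (t / real m) (dist_fun x u)) * indicator {0..} u)"
      using dist_fun_dilation_rearrangement[OF x m, of u] by (simp add: indicator_def ennreal_mult')
  qed
  also have "\<dots> = ennreal (real m) * cumulative x (t / real m)"
    using m t by (subst nn_integral_cmult) (simp_all add: cumulative_layer_cake[OF x])
  finally show ?thesis .
qed

text \<open>The functions \<open>(1/m) \<sigma>\<^sub>m (\<mu> x)\<close> whose norms occur in the theorem.\<close>
definition normalized_dilation :: "nat \<Rightarrow> (real \<Rightarrow> real) \<Rightarrow> real \<Rightarrow> real" where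
  "normalized_dilation m x = (\<lambda>t. 1 / real m * dilation m (rearrangement x) t)"

lemma normalized_dilation_measurable:
  "measurable_on_unit x \<Longrightarrow> 0 < m \<Longrightarrow> measurable_on_unit (normalized_dilation m x)"
  unfolding normalized_dilation_def using dilation_rearrangement_measurable[of x m] by simp

text \<open>Substitution in the integral: the factor \<open>1/m\<close> compensates the stretching.\<close>
lemma cumulative_normalized_dilation:
  assumes x: "measurable_on_unit x" and m: "0 < m" and t: "0 < t" "t \<le> 1"
  shows "cumulative (normalized_dilation m x) t = cumulative x (t / real m)"
proof -
  have "cumulative (normalized_dilation m x) t
      = ennreal (1 / real m) * (ennreal (real m) * cumulative x (t / real m))"
    unfolding normalized_dilation_def using m
    by (subst cumulative_scale[OF dilation_rearrangement_measurable[OF x m] t(1)])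
       (simp_all add: cumulative_dilation_rearrangement[OF assms])
  also have "\<dots> = ennreal (1 / real m * real m) * cumulative x (t / real m)"
    by (simp only: mult.assoc[symmetric] ennreal_mult'[symmetric] of_nat_0_le_iff zero_le_divide_1_iff)
  also have "1 / real m * real m = 1" using m by simp
  finally show ?thesis by simp
qed

lemma normalized_dilation_antimono:
  assumes x: "measurable_on_unit x" and m: "0 < m" "m \<le> n"
  shows "normalized_dilation n x \<prec>\<prec> normalized_dilation m x"
proof (rule submajorizedI)
  fix t :: real assume t: "0 < t" "t \<le> 1"
  have "cumulative x (t / real n) \<le> cumulative x (t / real m)"
    by (rule cumulative_mono) (use t m in \<open>simp add: frac_le\<close>)
  then show "cumulative (normalized_dilation n x) t \<le> cumulative (normalized_dilation m x) t"
    using m t by (simp add: cumulative_normalized_dilation[OF x])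
qed (use m in \<open>simp_all add: normalized_dilation_measurable[OF x]\<close>)

lemma normalized_dilation_L1: "x \<in> L1 \<Longrightarrow> 0 < m \<Longrightarrow> normalized_dilation m x \<in> L1"
  using cumulative_finite[of x "1 / real m"]
  by (simp add: L1_iff_cumulative normalized_dilation_measurable cumulative_normalized_dilation)

lemma normalized_dilation_submajorized:
  assumes x: "measurable_on_unit x" and m: "0 < m"
  shows "normalized_dilation m x \<prec>\<prec> x"
proof (rule submajorizedI)
  fix t :: real assume t: "0 < t" "t \<le> 1"
  have "cumulative x (t / real m) \<le> cumulative x t"
    by (rule cumulative_mono) (use t m in \<open>simp add: field_simps\<close>)
  then show "cumulative (normalized_dilation m x) t \<le> cumulative x t"
    by (simp add: cumulative_normalized_dilation[OF x m t])
qed (use m x in \<open>simp_all add: normalized_dilation_measurable[OF x]\<close>)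

section \<open>Sums of rearrangements and real-valued integrals\<close>

lemma cumulative_const:
  assumes "0 < t" "t \<le> 1" "0 \<le> C"
  shows "cumulative (\<lambda>v. C) t = ennreal (C * t)"
proof (rule antisym)
  show "cumulative (\<lambda>v. C) t \<le> ennreal (C * t)"
    by (rule cumulative_bounded) (use assms in simp_all)
  have "ennreal (C * t) = (\<integral>\<^sup>+s\<in>{0..t}. ennreal C \<partial>lborel)"
    using assms by (simp add: nn_integral_cmult_indicator ennreal_mult)
  also have "\<dots> \<le> cumulative (\<lambda>v. C) t"
    by (rule initial_integral_le_cumulative) (use assms in simp_all)
  finally show "ennreal (C * t) \<le> cumulative (\<lambda>v. C) t" .
qed

lemma rearrangement_eq_normalized_dilation: "rearrangement y = normalized_dilation 1 y"
  by (simp add: normalized_dilation_def dilation_def)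

text \<open>
  Rearranging \<open>y\<close> and \<open>z\<close> separately before adding removes the loss in subadditivity: the sum of the
  rearrangements is integrated over the initial interval.
\<close>
lemma cumulative_le_sum_of_rearrangements:
  assumes y: "measurable_on_unit y" and z: "measurable_on_unit z" and t: "0 < t" "t \<le> 1"
  shows "cumulative y t + cumulative z t \<le> cumulative (\<lambda>s. rearrangement y s + rearrangement z s) t"
proof -
  let ?r = "\<lambda>y s. if 0 < s then rearrangement y s else 0"
  note rearrangement_borel[OF y, measurable] rearrangement_borel[OF z, measurable]
  have eq: "cumulative y t = (\<integral>\<^sup>+s. ennreal (?r y s) * indicator {0..t} s \<partial>lborel)" for y
    unfolding cumulative_def
  proof (rule nn_integral_cong_AE)
    have "AE s in lborel. s \<noteq> (0::real)" by (rule AE_lborel_singleton)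
    then show "AE s in lborel. ennreal (rearrangement y s) * indicator {0..t} s
        = ennreal (?r y s) * indicator {0..t} s"
      by eventually_elim (simp add: indicator_def)
  qed
  have "cumulative y t + cumulative z t = (\<integral>\<^sup>+s. ennreal (?r y s) * indicator {0..t} s
      + ennreal (?r z s) * indicator {0..t} s \<partial>lborel)"
    unfolding eq by (rule nn_integral_add[symmetric]) measurable
  also have "\<dots> = (\<integral>\<^sup>+s\<in>{0..t}. ennreal (rearrangement y s + rearrangement z s) \<partial>lborel)"
  proof (rule nn_integral_cong_AE)
    have "AE s in lborel. s \<noteq> (0::real)" by (rule AE_lborel_singleton)
    then show "AE s in lborel. ennreal (?r y s) * indicator {0..t} s + ennreal (?r z s) * indicator {0..t} s
        = ennreal (rearrangement y s + rearrangement z s) * indicator {0..t} s"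
      by eventually_elim
        (auto simp: indicator_def rearrangement_nonneg[OF y] rearrangement_nonneg[OF z] ennreal_plus)
  qed
  also have "\<dots> \<le> cumulative (\<lambda>s. rearrangement y s + rearrangement z s) t"
  proof (rule initial_integral_le_cumulative[OF _ t])
    show "measurable_on_unit (\<lambda>s. rearrangement y s + rearrangement z s)"
      unfolding rearrangement_eq_normalized_dilation
      by (intro borel_measurable_add normalized_dilation_measurable y z) simp_all
  qed
  finally show ?thesis .
qed

text \<open>For integrable functions the integrals are finite; real values allow subtraction.\<close>
definition cumulative_real :: "(real \<Rightarrow> real) \<Rightarrow> real \<Rightarrow> real"  ("\<Phi>") where
  "\<Phi> y t = enn2real (cumulative y t)"

lemma ennreal_cumulative_real: "y \<in> L1 \<Longrightarrow> ennreal (\<Phi> y t) = cumulative y t"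
  using cumulative_finite[of y t] by (simp add: cumulative_real_def)

lemma cumulative_real_nonneg: "0 \<le> \<Phi> y t"
  by (simp add: cumulative_real_def)

lemma cumulative_le_iff_cumulative_real:
  "y \<in> L1 \<Longrightarrow> z \<in> L1 \<Longrightarrow> cumulative y s \<le> cumulative z t \<longleftrightarrow> \<Phi> y s \<le> \<Phi> z t"
  by (simp add: ennreal_cumulative_real[symmetric] cumulative_real_nonneg)

lemma cumulative_real_mono: "y \<in> L1 \<Longrightarrow> s \<le> t \<Longrightarrow> \<Phi> y s \<le> \<Phi> y t"
  by (simp add: cumulative_le_iff_cumulative_real[symmetric] cumulative_mono)

lemma L1_add: "y \<in> L1 \<Longrightarrow> z \<in> L1 \<Longrightarrow> (\<lambda>v. y v + z v) \<in> L1"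
  by (simp add: L1_def)

lemma cumulative_real_add_le:
  assumes "y \<in> L1" "z \<in> L1" "0 < t"
  shows "\<Phi> (\<lambda>v. y v + z v) t \<le> \<Phi> y t + \<Phi> z t"
proof -
  have "ennreal (\<Phi> (\<lambda>v. y v + z v) t) \<le> ennreal (\<Phi> y t) + ennreal (\<Phi> z t)"
    using assms by (simp add: ennreal_cumulative_real L1_add cumulative_add_le L1_measurable)
  then show ?thesis by (simp add: cumulative_real_nonneg ennreal_plus[symmetric] del: ennreal_plus)
qed

lemma cumulative_real_add_ge:
  assumes "y \<in> L1" "z \<in> L1" "AE v in unit_interval_measure. 0 \<le> y v"
    "AE v in unit_interval_measure. 0 \<le> z v" "0 < s" "0 < t"
  shows "\<Phi> y s + \<Phi> z t \<le> \<Phi> (\<lambda>v. y v + z v) (s + t)"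
proof -
  have "ennreal (\<Phi> y s) + ennreal (\<Phi> z t) \<le> ennreal (\<Phi> (\<lambda>v. y v + z v) (s + t))"
    using assms by (simp add: ennreal_cumulative_real L1_add cumulative_add_ge L1_measurable)
  then show ?thesis by (simp add: cumulative_real_nonneg ennreal_plus[symmetric] del: ennreal_plus)
qed

lemma cumulative_real_scale:
  assumes "y \<in> L1" "0 < t" "0 < r"
  shows "\<Phi> (\<lambda>v. r * y v) t = r * \<Phi> y t"
  using assms by (simp add: cumulative_real_def cumulative_scale L1_measurable enn2real_mult)


section \<open>Telescoping along a geometric progression\<close>

text \<open>
  Add up the hypothesis at the points \<open>s = r/m^j\<close> for \<open>j < k\<close>. The differences of \<open>B\<close> telescope, \<open>f\<close>
  and \<open>W\<close> are compared with their extreme values by monotonicity, and since \<open>m \<ge> 2\<close> the linear terms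
  are dominated by the geometric series with ratio \<open>1/2\<close>.
\<close>
lemma averaged_telescope:
  fixes f W B :: "real \<Rightarrow> real" and m C r :: real
  assumes m: "2 \<le> m" and C: "0 \<le> C" and r: "0 < r" "r \<le> 1"
    and f: "\<And>s t. 0 < s \<Longrightarrow> s \<le> t \<Longrightarrow> f s \<le> f t"
    and W: "\<And>s t. 0 < s \<Longrightarrow> s \<le> t \<Longrightarrow> W s \<le> W t"
    and step: "\<And>s. 0 < s \<Longrightarrow> s \<le> 1 \<Longrightarrow> f (s / m) \<le> W s + (B s - B (s / m)) + C * s"
  shows "real k * f (r / m ^ k) \<le> real k * W r + (B r - B (r / m ^ k)) + 2 * C * r * (1 - (1/2) ^ k)"
proof (induction k)
  case 0
  then show ?case by simp
next
  case (Suc k)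
  define s where "s = r / m ^ k"
  have s_pos: "0 < s" using r m by (simp add: s_def)
  have "s \<le> r * (1/2) ^ k"
  proof -
    have "(2::real) ^ k \<le> m ^ k" using m by (intro power_mono) simp_all
    then have "1 / m ^ k \<le> 1 / 2 ^ k" by (intro frac_le) simp_all
    then have "r * (1 / m ^ k) \<le> r * (1 / 2 ^ k)" using r by (intro mult_left_mono) simp_all
    then show ?thesis by (simp add: s_def power_divide)
  qed
  then have Cs: "C * s \<le> C * r * (1/2) ^ k"
    using C mult_left_mono[of s "r * (1/2)^k" C] by (simp add: mult.assoc)
  have "(1/2::real) ^ k \<le> 1" by (intro power_le_one) simp_all
  then have "r * (1/2) ^ k \<le> r" using r mult_left_mono[of "(1/2)^k" 1 r] by simp
  with \<open>s \<le> r * (1/2) ^ k\<close> have s_r: "s \<le> r" by simp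
  have sm: "s / m \<le> s" "0 < s / m" using s_pos m by (simp_all add: field_simps)
  have eq: "r / m ^ Suc k = s / m" by (simp add: s_def field_simps)
  have "real k * f (s / m) \<le> real k * f s" using f[OF sm(2,1)] by (intro mult_left_mono) simp_all
  moreover have "real k * f s \<le> real k * W r + (B r - B s) + 2 * C * r * (1 - (1/2) ^ k)"
    using Suc.IH by (simp add: s_def)
  moreover have "f (s / m) \<le> W s + (B s - B (s / m)) + C * s"
    using step[OF s_pos] s_r r by simp
  moreover have "W s \<le> W r" using W[OF s_pos s_r] .
  moreover have "2 * C * r * (1 - (1/2) ^ k) + C * r * (1/2) ^ k = 2 * C * r * (1 - (1/2) ^ Suc k)"
    by (simp add: algebra_simps)
  moreover have "real (Suc k) * f (s / m) = real k * f (s / m) + f (s / m)"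
    "real (Suc k) * W r = real k * W r + W r" by (simp_all add: algebra_simps)
  ultimately show ?case unfolding eq using Cs by linarith
qed


section \<open>Fully symmetric spaces and domination up to dilation\<close>

lemma linear_functional_onD:
  assumes "linear_functional_on E \<phi>"
  shows "\<forall>f\<in>E. \<forall>g\<in>E. (AE t in unit_interval_measure. f t = g t) \<longrightarrow> \<phi> f = \<phi> g"
    "\<forall>f\<in>E. \<forall>g\<in>E. \<phi> (\<lambda>t. f t + g t) = \<phi> f + \<phi> g"
    "\<forall>c. \<forall>f\<in>E. \<phi> (\<lambda>t. c * f t) = c * \<phi> f"
  using assms unfolding linear_functional_on_def by - (elim conjE, assumption)+

locale fully_symmetric_space =
  fixes E :: "(real \<Rightarrow> real) set" and N :: "(real \<Rightarrow> real) \<Rightarrow> real"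
  assumes fully_symmetric: "fully_symmetric_banach_space E N"
begin

lemma space_axioms:
  "(\<lambda>t. 0) \<in> E" "\<forall>f\<in>E. \<forall>g\<in>E. (\<lambda>t. f t + g t) \<in> E" "\<forall>c. \<forall>f\<in>E. (\<lambda>t. c * f t) \<in> E"
  "\<forall>f\<in>E. 0 \<le> N f" "\<forall>f\<in>E. N f = 0 \<longleftrightarrow> (AE t in unit_interval_measure. f t = 0)"
  "\<forall>c. \<forall>f\<in>E. N (\<lambda>t. c * f t) = \<bar>c\<bar> * N f"
  "\<forall>f\<in>E. \<forall>g\<in>E. N (\<lambda>t. f t + g t) \<le> N f + N g" "E \<subseteq> L1"
  "\<forall>x\<in>E. \<forall>y\<in>L1. y \<prec>\<prec> x \<longrightarrow> y \<in> E \<and> N y \<le> N x"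
  using fully_symmetric
  unfolding fully_symmetric_banach_space_def banach_function_space_def
  by - (elim conjE, assumption)+

lemmas zero_mem = space_axioms(1)
  and add_mem = space_axioms(2)[rule_format]
  and scale_mem = space_axioms(3)[rule_format]
  and norm_nonneg = space_axioms(4)[rule_format]
  and norm_null = space_axioms(5)[rule_format]
  and norm_scale = space_axioms(6)[rule_format]
  and norm_triangle = space_axioms(7)[rule_format]
  and mem_L1 = space_axioms(8)[THEN subsetD]

lemma submajorized_mem: "x \<in> E \<Longrightarrow> y \<in> L1 \<Longrightarrow> y \<prec>\<prec> x \<Longrightarrow> y \<in> E"
  and submajorized_norm_le: "x \<in> E \<Longrightarrow> y \<in> L1 \<Longrightarrow> y \<prec>\<prec> x \<Longrightarrow> N y \<le> N x"
  using space_axioms(9) by blast+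

lemma mem_measurable: "x \<in> E \<Longrightarrow> measurable_on_unit x"
  by (simp add: mem_L1 L1_measurable)

lemma diff_mem: "f \<in> E \<Longrightarrow> g \<in> E \<Longrightarrow> (\<lambda>t. f t - g t) \<in> E"
  using add_mem[OF _ scale_mem[of g "-1"], of f] by simp

lemma submajorized_cumulative_real: "y \<in> E \<Longrightarrow> x \<in> E \<Longrightarrow> y \<prec>\<prec> x \<Longrightarrow> 0 \<le> t \<Longrightarrow> \<Phi> y t \<le> \<Phi> x t"
  by (simp add: submajorized_iff_cumulative cumulative_le_iff_cumulative_real mem_L1)

lemma normalized_dilation_mem: "x \<in> E \<Longrightarrow> 0 < m \<Longrightarrow> normalized_dilation m x \<in> E"
  by (rule submajorized_mem[OF _ normalized_dilation_L1[OF mem_L1]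
      normalized_dilation_submajorized[OF mem_measurable]])

lemma norm_normalized_dilation_antimono:
  assumes "x \<in> E" "0 < m" "m \<le> n"
  shows "N (normalized_dilation n x) \<le> N (normalized_dilation m x)"
  using assms
  by (intro submajorized_norm_le normalized_dilation_mem normalized_dilation_L1 mem_L1
      normalized_dilation_antimono mem_measurable) simp_all

text \<open>
  Sums of integrals of rearrangements can be majorized by that of a single element of \<open>E\<close> without
  losing in norm.
\<close>
lemma exists_dominating_sum:
  assumes y: "y \<in> E" and z: "z \<in> E"
  obtains h where "h \<in> E" "N h \<le> N y + N z"
    "\<And>t. 0 < t \<Longrightarrow> t \<le> 1 \<Longrightarrow> \<Phi> y t + \<Phi> z t \<le> \<Phi> h t"
proof -
  define h where "h = (\<lambda>s. rearrangement y s + rearrangement z s)"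
  have mem: "rearrangement f \<in> E" and le: "N (rearrangement f) \<le> N f" if "f \<in> E" for f
    using normalized_dilation_mem[OF that, of 1] that
      submajorized_norm_le[OF that, of "normalized_dilation 1 f"]
      normalized_dilation_L1[of f 1] normalized_dilation_submajorized[of f 1]
    by (simp_all add: rearrangement_eq_normalized_dilation mem_L1 mem_measurable)
  have h: "h \<in> E" unfolding h_def by (rule add_mem[OF mem[OF y] mem[OF z]])
  have "N h \<le> N y + N z"
    unfolding h_def using norm_triangle[OF mem[OF y] mem[OF z]] le[OF y] le[OF z] by simp
  moreover have "\<Phi> y t + \<Phi> z t \<le> \<Phi> h t" if "0 < t" "t \<le> 1" for t
  proof -
    have "ennreal (\<Phi> y t) + ennreal (\<Phi> z t) \<le> ennreal (\<Phi> h t)"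
      using cumulative_le_sum_of_rearrangements[OF mem_measurable[OF y] mem_measurable[OF z] that]
      by (simp add: ennreal_cumulative_real mem_L1 y z h h_def[symmetric])
    then show ?thesis by (simp add: cumulative_real_nonneg ennreal_plus[symmetric] del: ennreal_plus)
  qed
  ultimately show thesis using h that by blast
qed

text \<open>
  Submajorization up to a dilation and a constant function. The dilation makes the relation
  additive, the constant makes bounded functions negligible. Constants are required to be in \<open>E\<close>
  because \<open>E\<close> may be the null space.
\<close>
definition dilation_dominated :: "(real \<Rightarrow> real) \<Rightarrow> (real \<Rightarrow> real) \<Rightarrow> bool" where
  "dilation_dominated b a \<longleftrightarrow> (\<exists>n C. 1 \<le> n \<and> 0 \<le> C \<and> (\<lambda>_. C) \<in> E \<and>
     (\<forall>r. 0 < r \<and> r \<le> 1 \<longrightarrow> \<Phi> b (r / real n) \<le> \<Phi> a r + C * r))"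

lemma submajorized_imp_dominated:
  assumes "b \<in> E" "a \<in> E" "b \<prec>\<prec> a"
  shows "dilation_dominated b a"
  unfolding dilation_dominated_def
  using submajorized_cumulative_real[OF assms] by (intro exI[of _ 1] exI[of _ 0]) (simp add: zero_mem)

text \<open>
  Superadditivity for the dominating functions costs a further factor \<open>2\<close> in the dilation; this is
  why the dilation must be arbitrary.
\<close>
lemma dilation_dominated_add:
  assumes "b \<in> E" "b' \<in> E" "a \<in> E" "a' \<in> E"
    and a0: "AE v in unit_interval_measure. 0 \<le> a v"
    and a'0: "AE v in unit_interval_measure. 0 \<le> a' v"
    and "dilation_dominated b a" "dilation_dominated b' a'"
  shows "dilation_dominated (\<lambda>v. b v + b' v) (\<lambda>v. a v + a' v)"
proof -
  obtain n C where n: "1 \<le> n" "0 \<le> C" "(\<lambda>_. C) \<in> E"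
    "\<And>r. 0 < r \<Longrightarrow> r \<le> 1 \<Longrightarrow> \<Phi> b (r / real n) \<le> \<Phi> a r + C * r"
    using assms(7) unfolding dilation_dominated_def by blast
  obtain n' C' where n': "1 \<le> n'" "0 \<le> C'" "(\<lambda>_. C') \<in> E"
    "\<And>r. 0 < r \<Longrightarrow> r \<le> 1 \<Longrightarrow> \<Phi> b' (r / real n') \<le> \<Phi> a' r + C' * r"
    using assms(8) unfolding dilation_dominated_def by blast
  have "\<Phi> (\<lambda>v. b v + b' v) (r / real (2 * n * n')) \<le> \<Phi> (\<lambda>v. a v + a' v) r + (C + C') * r"
    if r: "0 < r" "r \<le> 1" for r
  proof -
    let ?s = "r / real (2 * n * n')"
    have s: "0 < ?s" "?s \<le> (r/2) / real n" "?s \<le> (r/2) / real n'"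
      using r n(1) n'(1) by (auto simp: field_simps)
    have "\<Phi> (\<lambda>v. b v + b' v) ?s \<le> \<Phi> b ?s + \<Phi> b' ?s"
      by (rule cumulative_real_add_le) (use assms mem_L1 s in auto)
    also have "\<dots> \<le> \<Phi> b ((r/2) / real n) + \<Phi> b' ((r/2) / real n')"
      using s(2,3) assms mem_L1 by (intro add_mono cumulative_real_mono) auto
    also have "\<dots> \<le> (\<Phi> a (r/2) + C * (r/2)) + (\<Phi> a' (r/2) + C' * (r/2))"
      by (intro add_mono n(4) n'(4)) (use r in auto)
    also have "\<dots> \<le> (\<Phi> a (r/2) + \<Phi> a' (r/2)) + (C + C') * r"
      using mult_nonneg_nonneg[OF n(2), of r] mult_nonneg_nonneg[OF n'(2), of r] r
      by (simp add: algebra_simps)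
    also have "\<Phi> a (r/2) + \<Phi> a' (r/2) \<le> \<Phi> (\<lambda>v. a v + a' v) (r/2 + r/2)"
      by (rule cumulative_real_add_ge) (use assms mem_L1 r in auto)
    finally show ?thesis by simp
  qed
  then show ?thesis unfolding dilation_dominated_def
    using n(1,2) n'(1,2) add_mem[OF n(3) n'(3)]
    by (intro exI[of _ "2 * n * n'"] exI[of _ "C + C'"]) simp
qed

lemma dilation_dominated_scale:
  assumes b: "b \<in> E" and a: "a \<in> E" and c: "0 < c" and ba: "dilation_dominated b a"
  shows "dilation_dominated (\<lambda>v. c * b v) (\<lambda>v. c * a v)"
proof -
  obtain n C where n: "1 \<le> n" "0 \<le> C" "(\<lambda>_. C) \<in> E"
    "\<And>r. 0 < r \<Longrightarrow> r \<le> 1 \<Longrightarrow> \<Phi> b (r / real n) \<le> \<Phi> a r + C * r"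
    using ba unfolding dilation_dominated_def by blast
  have "\<Phi> (\<lambda>v. c * b v) (r / real n) \<le> \<Phi> (\<lambda>v. c * a v) r + (c * C) * r" if r: "0 < r" "r \<le> 1" for r
    using mult_left_mono[OF n(4)[OF r], of c] r c n(1)
      cumulative_real_scale[OF mem_L1[OF b], of "r / real n" c]
      cumulative_real_scale[OF mem_L1[OF a], of r c]
    by (simp add: algebra_simps)
  then show ?thesis unfolding dilation_dominated_def
    using n(1,2) c scale_mem[OF n(3), of c]
    by (intro exI[of _ n] exI[of _ "c * C"]) simp
qed

text \<open>
  Unless \<open>l\<close> vanishes almost everywhere, constants belong to \<open>E\<close>: by concavity they are submajorized
  by multiples of \<open>l\<close>.
\<close>
lemma bounded_by_constant:
  assumes l: "l \<in> E" "l \<in> Linf"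
  obtains C where "0 \<le> C" "(\<lambda>_. C) \<in> E" "\<And>t. 0 < t \<Longrightarrow> t \<le> 1 \<Longrightarrow> \<Phi> l t \<le> C * t"
proof (cases "\<Phi> l 1 = 0")
  case True
  have "\<Phi> l t \<le> 0 * t" if "t \<le> 1" for t
    using cumulative_real_mono[OF mem_L1[OF l(1)] that] True by simp
  then show thesis using that[of 0] zero_mem by simp
next
  case False
  then have J: "0 < \<Phi> l 1" using cumulative_real_nonneg[of l 1] by simp
  obtain C0 where C0: "AE v in unit_interval_measure. \<bar>l v\<bar> \<le> C0" using l(2) by (auto simp: Linf_def)
  define C where "C = max 1 C0"
  have C: "0 < C" "AE v in unit_interval_measure. \<bar>l v\<bar> \<le> C"
    using C0 by (auto simp: C_def elim: eventually_mono)
  have le: "\<Phi> l t \<le> C * t" if "0 < t" for t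
  proof -
    have "cumulative l t \<le> ennreal (C * t)"
      by (rule cumulative_bounded[OF mem_measurable[OF l(1)] that _ C(2)]) (use C in simp)
    then show ?thesis using that C by (simp add: ennreal_cumulative_real[OF mem_L1[OF l(1)], symmetric])
  qed
  let ?k = "C / \<Phi> l 1"
  have "(\<lambda>_. C) \<prec>\<prec> (\<lambda>v. ?k * l v)"
  proof (rule submajorizedI)
    fix t :: real assume t: "0 < t" "t \<le> 1"
    have "cumulative (\<lambda>_. C) t = ennreal (?k * (t * \<Phi> l 1))"
      using t C J by (simp add: cumulative_const)
    also have "\<dots> = ennreal ?k * (ennreal t * ennreal (\<Phi> l 1))"
      using t C J by (simp add: ennreal_mult'[symmetric])
    also have "\<dots> \<le> ennreal ?k * cumulative l t"
      using cumulative_ge_linear[OF mem_measurable[OF l(1)] t]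
      by (intro mult_left_mono) (simp_all add: ennreal_cumulative_real[OF mem_L1[OF l(1)]])
    also have "\<dots> = cumulative (\<lambda>v. ?k * l v) t"
      by (rule cumulative_scale[symmetric]) (use t C J mem_measurable[OF l(1)] in simp_all)
    finally show "cumulative (\<lambda>_. C) t \<le> cumulative (\<lambda>v. ?k * l v) t" .
  qed (use mem_measurable[OF scale_mem[OF l(1), of ?k]] in simp_all)
  then have "(\<lambda>_. C) \<in> E"
    by (rule submajorized_mem[OF scale_mem[OF l(1)], rotated])
       (simp add: L1_def finite_measure.integrable_const[OF unit_interval_finite])
  with C le show thesis using that[of C] by simp
qed

lemma bounded_imp_dominated:
  assumes "l \<in> E" "l \<in> Linf"
  shows "dilation_dominated l (\<lambda>_. 0)"
proof -
  obtain C where C: "0 \<le> C" "(\<lambda>_. C) \<in> E" "\<And>t. 0 < t \<Longrightarrow> t \<le> 1 \<Longrightarrow> \<Phi> l t \<le> C * t"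
    using bounded_by_constant[OF assms] by blast
  have "\<Phi> l (r / real 1) \<le> \<Phi> (\<lambda>_. 0) r + C * r" if "0 < r" "r \<le> 1" for r
    using C(3)[OF that] cumulative_real_nonneg[of "\<lambda>_. 0" r] by simp
  then show ?thesis unfolding dilation_dominated_def using C(1,2)
    by (intro exI[of _ 1] exI[of _ C]) simp
qed

text \<open>
  Adding a difference \<open>a - b\<close> in which \<open>a\<close> dominates \<open>b\<close> cannot bring the norm of \<open>c x\<close> below
  \<open>c p\<close>. Comparing \<open>\<Phi> (w + b)\<close> with \<open>\<Phi> (c x + a)\<close> costs a dilation by \<open>m\<close>, so that \<open>\<Phi> b r\<close> and
  \<open>\<Phi> b (r/m)\<close> fail to cancel. Averaging over the scales \<open>r/m^j\<close> removes this error, and the further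
  dilation of \<open>x\<close> that it causes does no harm because \<open>p\<close> is a lower bound for
  the norms of all normalized dilations.
\<close>
lemma norm_ge_of_dominated_perturbation:
  assumes x: "x \<in> E" "AE v in unit_interval_measure. 0 \<le> x v"
    and a: "a \<in> E" "AE v in unit_interval_measure. 0 \<le> a v"
    and b: "b \<in> E" and ba: "dilation_dominated b a"
    and p: "\<And>m. 0 < m \<Longrightarrow> p \<le> N (normalized_dilation m x)" and c: "0 \<le> c"
  shows "c * p \<le> N (\<lambda>v. c * x v + a v - b v)"
proof (cases "c = 0")
  case True
  then show ?thesis using norm_nonneg[OF diff_mem[OF a(1) b]] by simp
next
  case False
  with c have c: "0 < c" by simp
  define w where "w = (\<lambda>v. c * x v + a v - b v)"
  have cx: "(\<lambda>v. c * x v) \<in> E" by (rule scale_mem[OF x(1)])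
  have w: "w \<in> E" unfolding w_def by (rule diff_mem[OF add_mem[OF cx a(1)] b])
  note L = mem_L1[OF x(1)] mem_L1[OF a(1)] mem_L1[OF b] mem_L1[OF w] mem_L1[OF cx]
  obtain n C where n: "1 \<le> n" "0 \<le> C" "(\<lambda>_. C) \<in> E"
    "\<And>r. 0 < r \<Longrightarrow> r \<le> 1 \<Longrightarrow> \<Phi> b (r / real n) \<le> \<Phi> a r + C * r"
    using ba unfolding dilation_dominated_def by blast
  \<comment> \<open>One factor \<open>2\<close> splits \<open>c x + a\<close>, the factor \<open>n\<close> comes from the domination of \<open>b\<close> by \<open>a\<close>.\<close>
  define m where "m = 2 * n"
  have m: "2 \<le> real m" "0 < m" using n(1) by (simp_all add: m_def)
  have step: "c * \<Phi> x (r / real m) \<le> \<Phi> w r + (\<Phi> b r - \<Phi> b (r / real m)) + C * r"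
    if r: "0 < r" "r \<le> 1" for r
  proof -
    have rm: "r / real m = (r/2) / real n" by (simp add: m_def)
    have "c * \<Phi> x (r / real m) \<le> c * \<Phi> x (r/2)"
      using c r frac_le[of r r 2 "real m"] m by (intro mult_left_mono cumulative_real_mono L) simp_all
    also have "\<dots> = \<Phi> (\<lambda>v. c * x v) (r/2)" using cumulative_real_scale[OF L(1), of "r/2" c] r c by simp
    finally have 1: "c * \<Phi> x (r / real m) \<le> \<Phi> (\<lambda>v. c * x v) (r/2)" .
    have "\<Phi> b (r / real m) \<le> \<Phi> a (r/2) + C * (r/2)"
      unfolding rm by (rule n(4)) (use r in simp_all)
    moreover have "C * (r/2) \<le> C * r" using n(2) r by (intro mult_left_mono) simp_all
    ultimately have 2: "\<Phi> b (r / real m) \<le> \<Phi> a (r/2) + C * r" by simp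
    have "AE v in unit_interval_measure. 0 \<le> c * x v"
      using x(2) c by (auto elim: eventually_mono)
    then have "\<Phi> (\<lambda>v. c * x v) (r/2) + \<Phi> a (r/2) \<le> \<Phi> (\<lambda>v. c * x v + a v) (r/2 + r/2)"
      by (rule cumulative_real_add_ge[OF L(5,2) _ a(2)]) (use r in simp_all)
    also have "(\<lambda>v. c * x v + a v) = (\<lambda>v. w v + b v)" by (simp add: w_def)
    also have "\<Phi> (\<lambda>v. w v + b v) (r/2 + r/2) \<le> \<Phi> w r + \<Phi> b r"
      using cumulative_real_add_le[OF L(4,3) r(1)] by simp
    finally show ?thesis using 1 2 by linarith
  qed
  have C2: "(\<lambda>_. 2 * C) \<in> E" using scale_mem[OF n(3), of 2] by simp
  obtain h where h: "h \<in> E" "\<And>t. 0 < t \<Longrightarrow> t \<le> 1 \<Longrightarrow> \<Phi> b t + \<Phi> (\<lambda>_. 2 * C) t \<le> \<Phi> h t"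
    using exists_dominating_sum[OF b C2] by blast
  have bound: "c * p \<le> N w + N h / real k" if k: "0 < k" for k :: nat
  proof -
    define M where "M = m ^ k"
    have M: "0 < M" using m by (simp add: M_def)
    have hk: "(\<lambda>v. (1 / real k) * h v) \<in> E" by (rule scale_mem[OF h(1)])
    obtain g where g: "g \<in> E" "N g \<le> N w + N (\<lambda>v. (1 / real k) * h v)"
      "\<And>t. 0 < t \<Longrightarrow> t \<le> 1 \<Longrightarrow> \<Phi> w t + \<Phi> (\<lambda>v. (1 / real k) * h v) t \<le> \<Phi> g t"
      using exists_dominating_sum[OF w hk] by blast
    have sx: "normalized_dilation M x \<in> E" by (rule normalized_dilation_mem[OF x(1) M])
    have csx: "(\<lambda>v. c * normalized_dilation M x v) \<in> E" by (rule scale_mem[OF sx])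
    have "(\<lambda>v. c * normalized_dilation M x v) \<prec>\<prec> g"
    proof (rule submajorizedI)
      fix r :: real assume r: "0 < r" "r \<le> 1"
      have "real k * (c * \<Phi> x (r / real m ^ k))
          \<le> real k * \<Phi> w r + (\<Phi> b r - \<Phi> b (r / real m ^ k)) + 2 * C * r * (1 - (1/2) ^ k)"
      proof (rule averaged_telescope[OF m(1) n(2) r _ _ step])
        show "c * \<Phi> x s \<le> c * \<Phi> x t" if "s \<le> t" for s t
          using c by (intro mult_left_mono cumulative_real_mono L that) simp
      qed (use cumulative_real_mono[OF L(4)] in simp_all)
      also have "\<dots> \<le> real k * \<Phi> w r + \<Phi> b r + 2 * C * r"
      proof -
        have "2 * C * r * (1 - (1/2) ^ k) \<le> 2 * C * r * 1"
          using n(2) r by (intro mult_left_mono) simp_all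
        then show ?thesis using cumulative_real_nonneg[of b "r / real m ^ k"] by simp
      qed
      also have "2 * C * r = \<Phi> (\<lambda>_. 2 * C) r"
        using cumulative_const[of r "2 * C"] r n(2) by (simp add: cumulative_real_def)
      also have "real k * \<Phi> w r + \<Phi> b r + \<Phi> (\<lambda>_. 2 * C) r \<le> real k * \<Phi> w r + \<Phi> h r"
        using h(2)[OF r] by simp
      finally have "c * \<Phi> x (r / real M) \<le> \<Phi> w r + (1 / real k) * \<Phi> h r"
        using k by (simp add: M_def field_simps)
      also have "(1 / real k) * \<Phi> h r = \<Phi> (\<lambda>v. (1 / real k) * h v) r"
        using cumulative_real_scale[OF mem_L1[OF h(1)] r(1), of "1 / real k"] k by simp
      also have "\<Phi> w r + \<Phi> (\<lambda>v. (1 / real k) * h v) r \<le> \<Phi> g r" by (rule g(3)[OF r])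
      also have "c * \<Phi> x (r / real M) = \<Phi> (\<lambda>v. c * normalized_dilation M x v) r"
        using cumulative_real_scale[OF mem_L1[OF sx] r(1) c]
          cumulative_normalized_dilation[OF mem_measurable[OF x(1)] M r]
        by (simp add: cumulative_real_def)
      finally show "cumulative (\<lambda>v. c * normalized_dilation M x v) r \<le> cumulative g r"
        by (simp add: cumulative_le_iff_cumulative_real mem_L1 csx g(1))
    qed (simp_all add: mem_measurable csx g(1))
    then have "N (\<lambda>v. c * normalized_dilation M x v) \<le> N g"
      by (rule submajorized_norm_le[OF g(1) mem_L1[OF csx]])
    moreover have "c * p \<le> N (\<lambda>v. c * normalized_dilation M x v)"
      using p[OF M] c by (simp add: norm_scale[OF sx])
    moreover have "N (\<lambda>v. (1 / real k) * h v) = N h / real k"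
      using norm_scale[OF h(1), of "1 / real k"] by simp
    ultimately show ?thesis using g(2) by simp
  qed
  have "(\<lambda>k. N w + N h / real k) \<longlonglongrightarrow> N w + 0"
    by (intro tendsto_add tendsto_const lim_const_over_n)
  then have "c * p \<le> N w + 0"
    by (rule LIMSEQ_le_const) (use bound in \<open>auto intro!: exI[of _ 1]\<close>)
  then show ?thesis by (simp add: w_def)
qed

section \<open>The singular fully symmetric functional\<close>

lemma function_subspace_E: "function_subspace E"
  by (simp add: function_subspace_def zero_mem add_mem scale_mem)

lemma sublinear_norm: "sublinear_on E N"
  by (simp add: sublinear_on_def norm_triangle norm_scale)

text \<open>
  The norms decrease and are bounded below. At \<open>m = 0\<close> the expression is a conventional \<open>0\<close>, so the
  sequence is considered from \<open>m = 1\<close> on.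
\<close>
lemma norm_normalized_dilation_converges:
  assumes x: "x \<in> E"
  obtains p where "(\<lambda>m. 1 / real m * N (dilation m (rearrangement x))) \<longlonglongrightarrow> p" "0 \<le> p"
    "\<And>m. 0 < m \<Longrightarrow> p \<le> N (normalized_dilation m x)"
proof -
  let ?L = "\<lambda>m. N (normalized_dilation (Suc m) x)"
  have dec: "decseq ?L"
    by (rule decseq_SucI) (rule norm_normalized_dilation_antimono[OF x], simp_all)
  have lb: "0 \<le> ?L m" for m by (simp add: norm_nonneg normalized_dilation_mem[OF x])
  obtain p where p: "?L \<longlonglongrightarrow> p" "\<And>m. p \<le> ?L m"
    using decseq_convergent[OF dec, of 0] lb by blast
  have "1 / real (Suc m) * N (dilation (Suc m) (rearrangement x)) = ?L m" for m
  proof -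
    have "dilation (Suc m) (rearrangement x) = (\<lambda>t. real (Suc m) * normalized_dilation (Suc m) x t)"
      by (simp add: normalized_dilation_def)
    then show ?thesis by (simp add: norm_scale normalized_dilation_mem[OF x])
  qed
  then have "(\<lambda>m. 1 / real (Suc m) * N (dilation (Suc m) (rearrangement x))) \<longlonglongrightarrow> p"
    using p(1) by simp
  then have "(\<lambda>m. 1 / real m * N (dilation m (rearrangement x))) \<longlonglongrightarrow> p"
    by (rule LIMSEQ_imp_Suc)
  moreover have "0 \<le> p" using LIMSEQ_le_const[OF p(1)] lb by blast
  moreover have "p \<le> N (normalized_dilation m x)" if "0 < m" for m
    using p(2)[of "m - 1"] that by simp
  ultimately show thesis by (rule that)
qed

text \<open>Functions that agree almost everywhere have distance \<open>0\<close>, and \<open>\<phi>\<close> is bounded by the norm.\<close>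
lemma functional_ae_cong:
  assumes add: "\<And>f g. f \<in> E \<Longrightarrow> g \<in> E \<Longrightarrow> \<phi> (\<lambda>t. f t + g t) = \<phi> f + \<phi> g"
    and scale: "\<And>c f. f \<in> E \<Longrightarrow> \<phi> (\<lambda>t. c * f t) = c * \<phi> f"
    and le: "\<And>f. f \<in> E \<Longrightarrow> \<phi> f \<le> N f"
    and f: "f \<in> E" and g: "g \<in> E" and eq: "AE t in unit_interval_measure. f t = g t"
  shows "\<phi> f = \<phi> g"
proof -
  have le': "\<phi> f \<le> \<phi> g"
    if f: "f \<in> E" and g: "g \<in> E" and eq: "AE t in unit_interval_measure. f t = g t" for f g
  proof -
    have "AE t in unit_interval_measure. f t - g t = 0" using eq by eventually_elim simp
    then have "N (\<lambda>t. f t - g t) = 0" using norm_null[OF diff_mem[OF f g]] by simp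
    then have "\<phi> (\<lambda>t. f t - g t) \<le> 0" using le[OF diff_mem[OF f g]] by simp
    then show ?thesis using add[OF f scale_mem[OF g, of "-1"]] scale[OF g, of "-1"] by simp
  qed
  have "AE t in unit_interval_measure. g t = f t" using eq by eventually_elim simp
  then show ?thesis using le'[OF f g eq] le'[OF g f] by simp
qed

text \<open>
  The demands \<open>c p \<le> \<phi> (c x + a - b)\<close> form a weighted cone, by additivity of domination, and the norm
  satisfies them. The choices \<open>c = 1\<close>, \<open>a = b = 0\<close> and \<open>c = 0\<close> give the two properties of \<open>\<phi>\<close>.
\<close>
lemma functional_above_dominated_cone:
  assumes x: "x \<in> E" "AE v in unit_interval_measure. 0 \<le> x v"
    and p: "\<And>m. 0 < m \<Longrightarrow> p \<le> N (normalized_dilation m x)"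
  obtains \<phi> where "linear_functional_on E \<phi>" "p \<le> \<phi> x"
    "\<And>a b. a \<in> E \<Longrightarrow> b \<in> E \<Longrightarrow> AE v in unit_interval_measure. 0 \<le> a v
      \<Longrightarrow> dilation_dominated b a \<Longrightarrow> \<phi> b \<le> \<phi> a"
proof -
  let ?good = "\<lambda>c a b. 0 \<le> c \<and> a \<in> E \<and> b \<in> E
    \<and> (AE v in unit_interval_measure. 0 \<le> a v) \<and> dilation_dominated b a"
  define G where "G = {((\<lambda>v. c * x v + a v - b v), c * p) | c a b. ?good c a b}"
  have G_iff: "(k, d) \<in> G \<longleftrightarrow> (\<exists>c a b. k = (\<lambda>v. c * x v + a v - b v) \<and> d = c * p \<and> ?good c a b)" for k d
    by (simp add: G_def)
  have dom0: "dilation_dominated (\<lambda>_. 0) (\<lambda>_. 0)"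
    by (rule submajorized_imp_dominated) (simp_all add: zero_mem submajorized_iff_cumulative)
  have cone: "weighted_cone E G"
  proof (rule weighted_coneI)
    show "k \<in> E" if "(k, d) \<in> G" for k d
    proof -
      obtain c a b where "k = (\<lambda>v. c * x v + a v - b v) \<and> d = c * p \<and> ?good c a b"
        using \<open>(k, d) \<in> G\<close> unfolding G_iff by (elim exE)
      then show ?thesis by (simp add: diff_mem add_mem scale_mem x(1))
    qed
    show "((\<lambda>_. 0), 0) \<in> G"
      unfolding G_iff
      by (rule exI[of _ 0], rule exI[of _ "\<lambda>_. 0"], rule exI[of _ "\<lambda>_. 0"]) (simp add: zero_mem dom0)
    show "((\<lambda>t. k t + k' t), d + d') \<in> G" if G: "(k, d) \<in> G" and G': "(k', d') \<in> G" for k d k' d'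
    proof -
      obtain c a b where 1: "k = (\<lambda>v. c * x v + a v - b v) \<and> d = c * p \<and> ?good c a b"
        using G unfolding G_iff by (elim exE)
      obtain c' a' b' where 2: "k' = (\<lambda>v. c' * x v + a' v - b' v) \<and> d' = c' * p \<and> ?good c' a' b'"
        using G' unfolding G_iff by (elim exE)
      have "AE v in unit_interval_measure. 0 \<le> a v" "AE v in unit_interval_measure. 0 \<le> a' v"
        using 1 2 by simp_all
      then have "AE v in unit_interval_measure. 0 \<le> a v + a' v" by eventually_elim simp
      then have "?good (c + c') (\<lambda>v. a v + a' v) (\<lambda>v. b v + b' v)"
        using 1 2 by (simp add: add_mem dilation_dominated_add)
      then show ?thesis
        unfolding G_iff using 1 2
        by (intro exI[of _ "c + c'"] exI[of _ "\<lambda>v. a v + a' v"] exI[of _ "\<lambda>v. b v + b' v"])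
           (simp add: algebra_simps)
    qed
    show "((\<lambda>t. r * k t), r * d) \<in> G" if r: "r > 0" and G: "(k, d) \<in> G" for r k d
    proof -
      obtain c a b where 1: "k = (\<lambda>v. c * x v + a v - b v) \<and> d = c * p \<and> ?good c a b"
        using G unfolding G_iff by (elim exE)
      then have "AE v in unit_interval_measure. 0 \<le> a v" by simp
      then have "AE v in unit_interval_measure. 0 \<le> r * a v" by eventually_elim (use r in simp)
      then have "?good (r * c) (\<lambda>v. r * a v) (\<lambda>v. r * b v)"
        using 1 r by (simp add: scale_mem dilation_dominated_scale)
      then show ?thesis
        unfolding G_iff using 1
        by (intro exI[of _ "r * c"] exI[of _ "\<lambda>v. r * a v"] exI[of _ "\<lambda>v. r * b v"])
           (simp add: algebra_simps)
    qed
  qed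
  have below: "d \<le> N k" if "(k, d) \<in> G" for k d
  proof -
    obtain c a b where "k = (\<lambda>v. c * x v + a v - b v) \<and> d = c * p \<and> ?good c a b"
      using \<open>(k, d) \<in> G\<close> unfolding G_iff by (elim exE)
    then show ?thesis by (simp add: norm_ge_of_dominated_perturbation[OF x _ _ _ _ p])
  qed
  obtain \<phi> where add: "\<And>f g. f \<in> E \<Longrightarrow> g \<in> E \<Longrightarrow> \<phi> (\<lambda>t. f t + g t) = \<phi> f + \<phi> g"
    and scale: "\<And>c f. f \<in> E \<Longrightarrow> \<phi> (\<lambda>t. c * f t) = c * \<phi> f"
    and le: "\<And>f. f \<in> E \<Longrightarrow> \<phi> f \<le> N f" and ge: "\<And>k d. (k, d) \<in> G \<Longrightarrow> d \<le> \<phi> k"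
    using mazur_orlicz_on_cone[OF function_subspace_E sublinear_norm cone below] by blast
  have "(x, p) \<in> G"
    unfolding G_iff
    by (rule exI[of _ 1], rule exI[of _ "\<lambda>_. 0"], rule exI[of _ "\<lambda>_. 0"]) (simp add: zero_mem dom0)
  then have "p \<le> \<phi> x" by (rule ge)
  moreover have "\<phi> b \<le> \<phi> a"
    if a: "a \<in> E" and b: "b \<in> E" and "AE v in unit_interval_measure. 0 \<le> a v"
      "dilation_dominated b a" for a b
  proof -
    have "((\<lambda>v. a v - b v), 0) \<in> G"
      unfolding G_iff by (rule exI[of _ 0], rule exI[of _ a], rule exI[of _ b]) (simp add: that)
    then have "0 \<le> \<phi> (\<lambda>v. a v - b v)" by (rule ge)
    also have "\<phi> (\<lambda>v. a v - b v) = \<phi> a - \<phi> b"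
      using add[OF a scale_mem[OF b, of "-1"]] scale[OF b, of "-1"] by simp
    finally show ?thesis by simp
  qed
  moreover have "linear_functional_on E \<phi>"
    unfolding linear_functional_on_def
    by (intro conjI ballI allI impI functional_ae_cong[OF add scale le] add scale)
  ultimately show thesis by (intro that[of \<phi>])
qed

text \<open>Both \<open>l\<close> and \<open>- l\<close> are dominated by \<open>0\<close>.\<close>
lemma dominated_monotone_imp_singular:
  assumes lin: "linear_functional_on E \<phi>"
    and mono: "\<And>a b. a \<in> E \<Longrightarrow> b \<in> E \<Longrightarrow> AE v in unit_interval_measure. 0 \<le> a v
      \<Longrightarrow> dilation_dominated b a \<Longrightarrow> \<phi> b \<le> \<phi> a"
    and l: "l \<in> E" "l \<in> Linf"
  shows "\<phi> l = 0"
proof -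
  have scale: "\<phi> (\<lambda>t. c * f t) = c * \<phi> f" if "f \<in> E" for c f
    using linear_functional_onD(3)[OF lin] that by simp
  have le: "\<phi> l \<le> 0" if "l \<in> E" "l \<in> Linf" for l
    using mono[OF zero_mem that(1) _ bounded_imp_dominated[OF that]] scale[OF zero_mem, of 0] by simp
  have "(\<lambda>v. (-1) * l v) \<in> Linf" using l(2) by (auto simp: Linf_def)
  then have "\<phi> (\<lambda>v. (-1) * l v) \<le> 0" by (rule le[OF scale_mem[OF l(1)]])
  then show ?thesis using le[OF l] scale[OF l(1), of "-1"] by simp
qed

end

theorem theorem36:
  fixes E :: "(real \<Rightarrow> real) set" and N :: "(real \<Rightarrow> real) \<Rightarrow> real" and x :: "real \<Rightarrow> real"
  assumes "fully_symmetric_banach_space E N"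
    and "x \<in> E" and "AE t in unit_interval_measure. 0 \<le> x t"
  shows "\<exists>\<phi>. linear_functional_on E \<phi> \<and> fully_symmetric_functional E \<phi> \<and>
             singular_functional E \<phi> \<and>
             (\<lambda>m. 1 / real m * N (dilation m (rearrangement x))) \<longlonglongrightarrow> \<phi> x"
proof -
  interpret fully_symmetric_space E N by (rule fully_symmetric_space.intro) (rule assms(1))
  obtain p where lim: "(\<lambda>m. 1 / real m * N (dilation m (rearrangement x))) \<longlonglongrightarrow> p" and p: "0 \<le> p"
    "\<And>m. 0 < m \<Longrightarrow> p \<le> N (normalized_dilation m x)"
    using norm_normalized_dilation_converges[OF assms(2)] by blast
  obtain \<psi> where lin: "linear_functional_on E \<psi>" and px: "p \<le> \<psi> x"
    and mono: "\<And>a b. a \<in> E \<Longrightarrow> b \<in> E \<Longrightarrow> AE v in unit_interval_measure. 0 \<le> a v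
      \<Longrightarrow> dilation_dominated b a \<Longrightarrow> \<psi> b \<le> \<psi> a"
    using functional_above_dominated_cone[OF assms(2,3) p(2)] by blast
  \<comment> \<open>If \<open>\<psi> x = 0\<close> then \<open>p = 0\<close>, and division by zero gives \<open>c = 0\<close>, as it should.\<close>
  define c where "c = p / \<psi> x"
  have c: "0 \<le> c" "c * \<psi> x = p" using p(1) px by (auto simp: c_def)
  have "linear_functional_on E (\<lambda>f. c * \<psi> f)"
    unfolding linear_functional_on_def
  proof (intro conjI ballI allI impI)
    fix f g assume fg: "f \<in> E" "g \<in> E"
    show "c * \<psi> (\<lambda>t. f t + g t) = c * \<psi> f + c * \<psi> g"
      using linear_functional_onD(2)[OF lin] fg by (simp add: distrib_left)
    show "c * \<psi> f = c * \<psi> g" if "AE t in unit_interval_measure. f t = g t"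
      using linear_functional_onD(1)[OF lin, rule_format, OF fg that] by simp
  next
    fix r f assume "f \<in> E"
    then show "c * \<psi> (\<lambda>t. r * f t) = r * (c * \<psi> f)"
      using linear_functional_onD(3)[OF lin] by simp
  qed
  moreover have "fully_symmetric_functional E (\<lambda>f. c * \<psi> f)"
    unfolding fully_symmetric_functional_def
    using mono submajorized_imp_dominated c(1) by (auto intro!: mult_left_mono)
  moreover have "singular_functional E (\<lambda>f. c * \<psi> f)"
    using dominated_monotone_imp_singular[OF lin mono] by (auto simp: singular_functional_def)
  ultimately show ?thesis using lim c(2) by (intro exI[of _ "\<lambda>f. c * \<psi> f"]) simp
qed

end
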